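(* Let $\mathfrak g$ be a Kac--Moody algebra. For every $\lambda\in\mathfrak h^*$ one has the equality of sets $$\operatorname{wt} L(\lambda)=\bigsqcup_{\mu\in\mathbb Z^{\geqslant 0}\{\alpha_i:\ i\in I\setminus I_\lambda\}}\operatorname{wt} L_{\mathfrak l_\lambda}(\lambda-\mu),$$ the union on the right being disjoint.
   Context: Let $I$ be a finite set, $A=(a_{ij})_{i,j\in I}$ a generalized Cartan matrix, and $(\mathfrak h,\{\alpha_i\},\{\check\alpha_i\})$ a realization over $\mathbb C$, i.e. $\dim\mathfrak h=2|I|-\operatorname{rk}A$, with linearly independent simple roots $\alpha_i\in\mathfrak h^*$ and linearly independent simple coroots $\check\alpha_i\in\mathfrak h$ with $\langle\check\alpha_i,\alpha_j\rangle=a_{ij}$. $\mathfrak g=\mathfrak g(A)$ is the Lie algebra generated by $\mathfrak h$ and $e_i,f_i$ ($i\in I$) with relations $[\mathfrak h,\mathfrak h]=0$, $[h,e_i]=\langle h,\alpha_i\rangle e_i$, $[h,f_i]=-\langle h,\alpha_i\rangle f_i$, $[e_i,f_j]=\delta_{ij}\check\alpha_i$ and the Serre relations $(\operatorname{ad}e_i)^{1-a_{ij}}e_j=0=(\operatorname{ad}f_i)^{1-a_{ij}}f_j$ for $i\ne j$; $\mathfrak g=\mathfrak n^-\oplus\mathfrak h\oplus\mathfrak n^+$ is the triangular decomposition. For an $\mathfrak h$-module $M$ and $\mu\in\mathfrak h^*$, $M_\mu=\{m: hm=\langle h,\mu\rangle m\ \forall h\in\mathfrak h\}$ and $\operatorname{wt}M=\{\mu: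 M_\mu\neq0\}$. $L(\lambda)$ is the simple highest weight $\mathfrak g$-module with highest weight $\lambda$. $I_\lambda=\{i\in I:\langle\check\alpha_i,\lambda\rangle\in\mathbb Z^{\geqslant0}\}$. $\mathfrak l_\lambda$ is the standard Levi subalgebra of $\mathfrak g$ generated by $\mathfrak h$ and $e_i,f_i$ for $i\in I_\lambda$, and $L_{\mathfrak l_\lambda}(\nu)$ is the simple highest weight $\mathfrak l_\lambda$-module of highest weight $\nu\in\mathfrak h^*$ (with respect to $\mathfrak h\oplus(\mathfrak n^+\cap\mathfrak l_\lambda)$). $\mathbb Z^{\geqslant0}S$ is the set of finite $\mathbb Z^{\geqslant0}$-linear combinations of elements of $S$. *)

theory Defs
  imports Complex_Main "HOL-Library.Function_Algebras" "HOL-Library.Disjoint_Sets"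
begin

section \<open>Complex Lie algebras on a carrier set, and their modules\<close>

record 'g lie_algebra =
  lie_carrier :: "'g set"
  lie_zero :: 'g
  lie_add :: "'g \<Rightarrow> 'g \<Rightarrow> 'g"
  lie_scale :: "complex \<Rightarrow> 'g \<Rightarrow> 'g"
  lie_bracket :: "'g \<Rightarrow> 'g \<Rightarrow> 'g"

text \<open>The Lie subalgebra generated by a set; for a subalgebra \<open>L\<close> of \<open>G\<close>, the Lie algebra
  \<open>L\<close> itself is \<open>G\<lparr>lie_carrier := L\<rparr>\<close>.\<close>

inductive_set lie_generated :: "('g, 'm) lie_algebra_scheme \<Rightarrow> 'g set \<Rightarrow> 'g set"
  for G S where
  gen: "x \<in> S \<Longrightarrow> x \<in> lie_generated G S"
| zero: "lie_zero G \<in> lie_generated G S"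
| add: "x \<in> lie_generated G S \<Longrightarrow> y \<in> lie_generated G S \<Longrightarrow> lie_add G x y \<in> lie_generated G S"
| scale: "x \<in> lie_generated G S \<Longrightarrow> lie_scale G c x \<in> lie_generated G S"
| bracket: "x \<in> lie_generated G S \<Longrightarrow> y \<in> lie_generated G S \<Longrightarrow>
    lie_bracket G x y \<in> lie_generated G S"

text \<open>The underlying space of a module is a subspace \<open>mod_carrier M\<close> of an ambient complex vector
  space \<open>'v\<close> with scalar multiplication \<open>mod_scale M\<close>; addition is that of \<open>'v\<close>. Thus modules of
  different dimensions can share a type. The action \<open>mod_act M x v\<close> is only meaningful for \<open>x\<close> in
  the Lie algebra and \<open>v\<close> in \<open>mod_carrier M\<close>.\<close>

record ('g, 'v) lie_mod =
  mod_scale :: "complex \<Rightarrow> 'v \<Rightarrow> 'v"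
  mod_carrier :: "'v set"
  mod_act :: "'g \<Rightarrow> 'v \<Rightarrow> 'v"

definition lie_module ::
  "('g, 'm) lie_algebra_scheme \<Rightarrow> ('g, 'v::ab_group_add) lie_mod \<Rightarrow> bool" where
  "lie_module G M \<longleftrightarrow>
     vector_space (mod_scale M) \<and> module.subspace (mod_scale M) (mod_carrier M) \<and>
     (\<forall>x\<in>lie_carrier G. \<forall>v\<in>mod_carrier M. mod_act M x v \<in> mod_carrier M) \<and>
     (\<forall>x\<in>lie_carrier G. \<forall>v\<in>mod_carrier M. \<forall>w\<in>mod_carrier M.
        mod_act M x (v + w) = mod_act M x v + mod_act M x w) \<and>
     (\<forall>x\<in>lie_carrier G. \<forall>c. \<forall>v\<in>mod_carrier M.
        mod_act M x (mod_scale M c v) = mod_scale M c (mod_act M x v)) \<and>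
     (\<forall>x\<in>lie_carrier G. \<forall>y\<in>lie_carrier G. \<forall>v\<in>mod_carrier M.
        mod_act M (lie_add G x y) v = mod_act M x v + mod_act M y v) \<and>
     (\<forall>x\<in>lie_carrier G. \<forall>c. \<forall>v\<in>mod_carrier M.
        mod_act M (lie_scale G c x) v = mod_scale M c (mod_act M x v)) \<and>
     (\<forall>x\<in>lie_carrier G. \<forall>y\<in>lie_carrier G. \<forall>v\<in>mod_carrier M.
        mod_act M (lie_bracket G x y) v =
          mod_act M x (mod_act M y v) - mod_act M y (mod_act M x v))"

definition submodule ::
  "('g, 'm) lie_algebra_scheme \<Rightarrow> ('g, 'v::ab_group_add) lie_mod \<Rightarrow> 'v set \<Rightarrow> bool" where
  "submodule G M U \<longleftrightarrow>
     module.subspace (mod_scale M) U \<and> U \<subseteq> mod_carrier M \<and>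
     (\<forall>x\<in>lie_carrier G. \<forall>u\<in>U. mod_act M x u \<in> U)"

definition simple_module ::
  "('g, 'm) lie_algebra_scheme \<Rightarrow> ('g, 'v::ab_group_add) lie_mod \<Rightarrow> bool" where
  "simple_module G M \<longleftrightarrow>
     lie_module G M \<and> mod_carrier M \<noteq> {0} \<and>
     (\<forall>U. submodule G M U \<longrightarrow> U = {0} \<or> U = mod_carrier M)"

section \<open>Lie algebras by generators and relations\<close>

datatype (lie_gens: 'x) lie_term =
    LGen 'x
  | LZero
  | LAdd "'x lie_term" "'x lie_term"
  | LScale complex "'x lie_term"
  | LBr "'x lie_term" "'x lie_term"

definition lie_terms :: "'x set \<Rightarrow> 'x lie_term set" where
  "lie_terms X = {t. lie_gens t \<subseteq> X}"

text \<open>The least congruence on the terms over \<open>X\<close> that contains the relations \<open>R\<close> (pairs of terms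
  to be identified) and whose quotient is a complex Lie algebra.\<close>

inductive_set lie_cong ::
  "'x set \<Rightarrow> ('x lie_term \<times> 'x lie_term) set \<Rightarrow> ('x lie_term \<times> 'x lie_term) set"
  for X R where
  rel: "(s, t) \<in> R \<Longrightarrow> s \<in> lie_terms X \<Longrightarrow> t \<in> lie_terms X \<Longrightarrow> (s, t) \<in> lie_cong X R"
| refl: "s \<in> lie_terms X \<Longrightarrow> (s, s) \<in> lie_cong X R"
| sym: "(s, t) \<in> lie_cong X R \<Longrightarrow> (t, s) \<in> lie_cong X R"
| trans: "(s, t) \<in> lie_cong X R \<Longrightarrow> (t, u) \<in> lie_cong X R \<Longrightarrow> (s, u) \<in> lie_cong X R"
| cong_add: "(s, s') \<in> lie_cong X R \<Longrightarrow> (t, t') \<in> lie_cong X R \<Longrightarrow>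
    (LAdd s t, LAdd s' t') \<in> lie_cong X R"
| cong_scale: "(s, s') \<in> lie_cong X R \<Longrightarrow> (LScale c s, LScale c s') \<in> lie_cong X R"
| cong_br: "(s, s') \<in> lie_cong X R \<Longrightarrow> (t, t') \<in> lie_cong X R \<Longrightarrow>
    (LBr s t, LBr s' t') \<in> lie_cong X R"
| add_assoc: "s \<in> lie_terms X \<Longrightarrow> t \<in> lie_terms X \<Longrightarrow> u \<in> lie_terms X \<Longrightarrow>
    (LAdd (LAdd s t) u, LAdd s (LAdd t u)) \<in> lie_cong X R"
| add_comm: "s \<in> lie_terms X \<Longrightarrow> t \<in> lie_terms X \<Longrightarrow> (LAdd s t, LAdd t s) \<in> lie_cong X R"
| add_zero: "s \<in> lie_terms X \<Longrightarrow> (LAdd s LZero, s) \<in> lie_cong X R"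
| add_neg: "s \<in> lie_terms X \<Longrightarrow> (LAdd s (LScale (-1) s), LZero) \<in> lie_cong X R"
| scale_add: "s \<in> lie_terms X \<Longrightarrow> t \<in> lie_terms X \<Longrightarrow>
    (LScale c (LAdd s t), LAdd (LScale c s) (LScale c t)) \<in> lie_cong X R"
| add_scale: "s \<in> lie_terms X \<Longrightarrow>
    (LScale (c + d) s, LAdd (LScale c s) (LScale d s)) \<in> lie_cong X R"
| scale_scale: "s \<in> lie_terms X \<Longrightarrow> (LScale c (LScale d s), LScale (c * d) s) \<in> lie_cong X R"
| scale_one: "s \<in> lie_terms X \<Longrightarrow> (LScale 1 s, s) \<in> lie_cong X R"
| br_add_left: "s \<in> lie_terms X \<Longrightarrow> t \<in> lie_terms X \<Longrightarrow> u \<in> lie_terms X \<Longrightarrow>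
    (LBr (LAdd s t) u, LAdd (LBr s u) (LBr t u)) \<in> lie_cong X R"
| br_add_right: "s \<in> lie_terms X \<Longrightarrow> t \<in> lie_terms X \<Longrightarrow> u \<in> lie_terms X \<Longrightarrow>
    (LBr s (LAdd t u), LAdd (LBr s t) (LBr s u)) \<in> lie_cong X R"
| br_scale_left: "s \<in> lie_terms X \<Longrightarrow> t \<in> lie_terms X \<Longrightarrow>
    (LBr (LScale c s) t, LScale c (LBr s t)) \<in> lie_cong X R"
| br_scale_right: "s \<in> lie_terms X \<Longrightarrow> t \<in> lie_terms X \<Longrightarrow>
    (LBr s (LScale c t), LScale c (LBr s t)) \<in> lie_cong X R"
| br_self: "s \<in> lie_terms X \<Longrightarrow> (LBr s s, LZero) \<in> lie_cong X R"
| jacobi: "s \<in> lie_terms X \<Longrightarrow> t \<in> lie_terms X \<Longrightarrow> u \<in> lie_terms X \<Longrightarrow>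
    (LAdd (LBr s (LBr t u)) (LAdd (LBr t (LBr u s)) (LBr u (LBr s t))), LZero) \<in> lie_cong X R"

definition presented_lie_algebra ::
  "'x set \<Rightarrow> ('x lie_term \<times> 'x lie_term) set \<Rightarrow> 'x lie_term set lie_algebra" where
  "presented_lie_algebra X R =
    \<lparr> lie_carrier = lie_terms X // lie_cong X R,
      lie_zero = lie_cong X R `` {LZero},
      lie_add = (\<lambda>A B. \<Union>s\<in>A. \<Union>t\<in>B. lie_cong X R `` {LAdd s t}),
      lie_scale = (\<lambda>c A. \<Union>s\<in>A. lie_cong X R `` {LScale c s}),
      lie_bracket = (\<lambda>A B. \<Union>s\<in>A. \<Union>t\<in>B. lie_cong X R `` {LBr s t}) \<rparr>"

section \<open>Generalized Cartan matrices and realizations\<close>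

text \<open>The Cartan subalgebra is the whole type \<open>'h\<close> with scalar multiplication \<open>hscale D\<close>; elements
  of its dual are linear functions \<open>'h \<Rightarrow> complex\<close>, so that the pairing of \<open>h\<close> and \<open>\<mu>\<close> is \<open>\<mu> h\<close>.
  The index set \<open>I\<close> of the Cartan matrix is the set \<open>index_set D\<close>, and the remaining data are only
  meaningful on it.\<close>

record ('h, 'i) km_datum =
  hscale :: "complex \<Rightarrow> 'h \<Rightarrow> 'h"
  index_set :: "'i set"
  cartan :: "'i \<Rightarrow> 'i \<Rightarrow> int"
  simple_root :: "'i \<Rightarrow> 'h \<Rightarrow> complex"
  simple_coroot :: "'i \<Rightarrow> 'h"

definition gcm :: "'i set \<Rightarrow> ('i \<Rightarrow> 'i \<Rightarrow> int) \<Rightarrow> bool" where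
  "gcm I A \<longleftrightarrow> finite I \<and> (\<forall>i\<in>I. A i i = 2) \<and>
     (\<forall>i\<in>I. \<forall>j\<in>I. i \<noteq> j \<longrightarrow> A i j \<le> 0) \<and>
     (\<forall>i\<in>I. \<forall>j\<in>I. A i j = 0 \<longleftrightarrow> A j i = 0)"

definition fun_scale :: "complex \<Rightarrow> ('a \<Rightarrow> complex) \<Rightarrow> 'a \<Rightarrow> complex" where
  "fun_scale c f = (\<lambda>x. c * f x)"

text \<open>The rank is the dimension of the column space.\<close>

definition matrix_rank :: "'i set \<Rightarrow> ('i \<Rightarrow> 'i \<Rightarrow> int) \<Rightarrow> nat" where
  "matrix_rank I A =
     vector_space.dim fun_scale ((\<lambda>j i. if i \<in> I then of_int (A i j) else 0) ` I)"

definition lin_indep_family ::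
  "(complex \<Rightarrow> 'a \<Rightarrow> 'a::ab_group_add) \<Rightarrow> 'i set \<Rightarrow> ('i \<Rightarrow> 'a) \<Rightarrow> bool" where
  "lin_indep_family sc I x \<longleftrightarrow> inj_on x I \<and> \<not> module.dependent sc (x ` I)"

definition hdual :: "('h::ab_group_add, 'i) km_datum \<Rightarrow> ('h \<Rightarrow> complex) set" where
  "hdual D = {\<mu>. Vector_Spaces.linear (hscale D) (*) \<mu>}"

definition realization :: "('h::ab_group_add, 'i) km_datum \<Rightarrow> bool" where
  "realization D \<longleftrightarrow>
     gcm (index_set D) (cartan D) \<and>
     vector_space (hscale D) \<and>
     (\<exists>B. finite B \<and> \<not> module.dependent (hscale D) B \<and> module.span (hscale D) B = UNIV \<and>
        card B = 2 * card (index_set D) - matrix_rank (index_set D) (cartan D)) \<and>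
     (\<forall>i\<in>index_set D. simple_root D i \<in> hdual D) \<and>
     lin_indep_family fun_scale (index_set D) (simple_root D) \<and>
     lin_indep_family (hscale D) (index_set D) (simple_coroot D) \<and>
     (\<forall>i\<in>index_set D. \<forall>j\<in>index_set D. simple_root D j (simple_coroot D i) = of_int (cartan D i j))"

section \<open>The Kac--Moody algebra\<close>

datatype ('h, 'i) km_gen = GH 'h | GE 'i | GF 'i

definition km_gens :: "('h, 'i) km_datum \<Rightarrow> ('h, 'i) km_gen set" where
  "km_gens D = range GH \<union> GE ` index_set D \<union> GF ` index_set D"

text \<open>The relations \<open>h_add\<close> and \<open>h_scale\<close> make the map from the Cartan subalgebra linear: it enters
  the presentation as a vector space and not just as a set of generators.\<close>

inductive_set km_rels ::
  "('h::ab_group_add, 'i) km_datum \<Rightarrow> (('h, 'i) km_gen lie_term \<times> ('h, 'i) km_gen lie_term) set"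
  for D where
  h_add: "(LGen (GH (h + k)), LAdd (LGen (GH h)) (LGen (GH k))) \<in> km_rels D"
| h_scale: "(LGen (GH (hscale D c h)), LScale c (LGen (GH h))) \<in> km_rels D"
| h_h: "(LBr (LGen (GH h)) (LGen (GH k)), LZero) \<in> km_rels D"
| h_e: "i \<in> index_set D \<Longrightarrow>
    (LBr (LGen (GH h)) (LGen (GE i)), LScale (simple_root D i h) (LGen (GE i))) \<in> km_rels D"
| h_f: "i \<in> index_set D \<Longrightarrow>
    (LBr (LGen (GH h)) (LGen (GF i)), LScale (- simple_root D i h) (LGen (GF i))) \<in> km_rels D"
| e_f_same: "i \<in> index_set D \<Longrightarrow>
    (LBr (LGen (GE i)) (LGen (GF i)), LGen (GH (simple_coroot D i))) \<in> km_rels D"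
| e_f_diff: "i \<in> index_set D \<Longrightarrow> j \<in> index_set D \<Longrightarrow> i \<noteq> j \<Longrightarrow>
    (LBr (LGen (GE i)) (LGen (GF j)), LZero) \<in> km_rels D"
| serre_e: "i \<in> index_set D \<Longrightarrow> j \<in> index_set D \<Longrightarrow> i \<noteq> j \<Longrightarrow>
    ((LBr (LGen (GE i)) ^^ nat (1 - cartan D i j)) (LGen (GE j)), LZero) \<in> km_rels D"
| serre_f: "i \<in> index_set D \<Longrightarrow> j \<in> index_set D \<Longrightarrow> i \<noteq> j \<Longrightarrow>
    ((LBr (LGen (GF i)) ^^ nat (1 - cartan D i j)) (LGen (GF j)), LZero) \<in> km_rels D"

type_synonym ('h, 'i) km_elem = "('h, 'i) km_gen lie_term set"

definition km_algebra :: "('h::ab_group_add, 'i) km_datum \<Rightarrow> ('h, 'i) km_elem lie_algebra" where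
  "km_algebra D = presented_lie_algebra (km_gens D) (km_rels D)"

definition km_gen_class ::
  "('h::ab_group_add, 'i) km_datum \<Rightarrow> ('h, 'i) km_gen \<Rightarrow> ('h, 'i) km_elem" where
  "km_gen_class D x = lie_cong (km_gens D) (km_rels D) `` {LGen x}"

definition n_plus :: "('h::ab_group_add, 'i) km_datum \<Rightarrow> ('h, 'i) km_elem set" where
  "n_plus D = lie_generated (km_algebra D) (km_gen_class D ` GE ` index_set D)"

definition levi :: "('h::ab_group_add, 'i) km_datum \<Rightarrow> 'i set \<Rightarrow> ('h, 'i) km_elem set" where
  "levi D J = lie_generated (km_algebra D)
     (km_gen_class D ` (range GH \<union> GE ` J \<union> GF ` J))"

definition levi_algebra ::
  "('h::ab_group_add, 'i) km_datum \<Rightarrow> 'i set \<Rightarrow> ('h, 'i) km_elem lie_algebra" where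
  "levi_algebra D J = (km_algebra D)\<lparr>lie_carrier := levi D J\<rparr>"

section \<open>Weights and simple highest weight modules\<close>

definition weight_space ::
  "('h::ab_group_add, 'i) km_datum \<Rightarrow> (('h, 'i) km_elem, 'v) lie_mod \<Rightarrow>
   ('h \<Rightarrow> complex) \<Rightarrow> 'v set" where
  "weight_space D M \<mu> =
     {m \<in> mod_carrier M. \<forall>h. mod_act M (km_gen_class D (GH h)) m = mod_scale M (\<mu> h) m}"

definition wt ::
  "('h::ab_group_add, 'i) km_datum \<Rightarrow> (('h, 'i) km_elem, 'v::ab_group_add) lie_mod \<Rightarrow>
   ('h \<Rightarrow> complex) set" where
  "wt D M = {\<mu> \<in> hdual D. weight_space D M \<mu> \<noteq> {0}}"

text \<open>Here \<open>G\<close> is the Kac--Moody algebra or one of its standard Levi subalgebras. A highest weight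
  module is one generated by a nonzero weight vector that is killed by the part of
  \<open>n_plus D\<close> lying in \<open>G\<close>.\<close>

definition highest_weight_module ::
  "('h::ab_group_add, 'i) km_datum \<Rightarrow> ('h, 'i) km_elem lie_algebra \<Rightarrow>
   (('h, 'i) km_elem, 'v::ab_group_add) lie_mod \<Rightarrow> ('h \<Rightarrow> complex) \<Rightarrow> bool" where
  "highest_weight_module D G M \<nu> \<longleftrightarrow>
     lie_module G M \<and>
     (\<exists>v\<in>weight_space D M \<nu>. v \<noteq> 0 \<and>
        (\<forall>x\<in>n_plus D \<inter> lie_carrier G. mod_act M x v = 0) \<and>
        (\<forall>U. submodule G M U \<and> v \<in> U \<longrightarrow> U = mod_carrier M))"

definition simple_highest_weight_module ::
  "('h::ab_group_add, 'i) km_datum \<Rightarrow> ('h, 'i) km_elem lie_algebra \<Rightarrow>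
   (('h, 'i) km_elem, 'v::ab_group_add) lie_mod \<Rightarrow> ('h \<Rightarrow> complex) \<Rightarrow> bool" where
  "simple_highest_weight_module D G M \<nu> \<longleftrightarrow>
     highest_weight_module D G M \<nu> \<and> simple_module G M"

definition integral_index :: "('h, 'i) km_datum \<Rightarrow> ('h \<Rightarrow> complex) \<Rightarrow> 'i set" where
  "integral_index D lam = {i \<in> index_set D. lam (simple_coroot D i) \<in> \<nat>}"

definition nonneg_span :: "('h \<Rightarrow> complex) set \<Rightarrow> ('h \<Rightarrow> complex) set" where
  "nonneg_span S = {\<mu>. \<exists>T (n :: ('h \<Rightarrow> complex) \<Rightarrow> nat). finite T \<and> T \<subseteq> S \<and>
     \<mu> = (\<lambda>h. \<Sum>\<beta>\<in>T. of_nat (n \<beta>) * \<beta> h)}"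

end

theory Submission
  imports Defs
begin

text \<open>
  Write \<open>J\<close> for \<open>integral_index D lam\<close> and \<open>I\<close> for \<open>index_set D\<close>. The vectors on which \<open>f\<^sub>i\<close> is
  nilpotent form a submodule, so on the simple module \<open>L\<close> the operator \<open>f\<^sub>i\<close> is locally nilpotent
  if \<open>i \<in> J\<close> and injective otherwise. Injectivity makes \<open>lam - \<mu>\<close> a weight of \<open>L\<close> for every \<open>\<mu>\<close> in
  the cone over \<open>I - J\<close>. The slice of \<open>L\<close> at \<open>\<mu>\<close> consists of its weights in \<open>lam - \<mu>\<close> minus the cone
  over \<open>J\<close>; it and the weights of \<open>LL \<mu>\<close> share these properties: they contain \<open>lam - \<mu>\<close>, are stable
  under the simple reflections in \<open>J\<close>, contain the first step of each string, and contain no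
  degenerate weight, since a monomial in the \<open>f\<^sub>j\<close> whose letters in some \<open>Z \<subseteq> J\<close> commute with all
  others kills the highest weight vector when \<open>lam\<close> vanishes on \<open>Z\<close>. As in Kac's description of the
  weights of an integrable highest weight module, these properties determine the set.
\<close>

section \<open>Combinatorics of weights\<close>

text \<open>\<open>L\<close> records the values of a top weight \<open>\<Lambda>\<close> at the simple coroots, and \<open>\<beta>\<close> stands for the weight
  \<open>\<Lambda> - (\<Sum>j\<in>J. \<beta> j \<alpha>\<^sub>j)\<close>.\<close>

definition pairing :: "'i set \<Rightarrow> ('i \<Rightarrow> 'i \<Rightarrow> int) \<Rightarrow> ('i \<Rightarrow> int) \<Rightarrow> ('i \<Rightarrow> nat) \<Rightarrow> 'i \<Rightarrow> int" where
  "pairing J A L \<beta> i = L i - (\<Sum>j\<in>J. A i j * int (\<beta> j))"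

lemma pairing_update:
  assumes "finite J" "i \<in> J" "A i i = 2"
  shows "pairing J A L (\<beta>(i := n)) i = pairing J A L \<beta> i - 2 * (int n - int (\<beta> i))"
proof -
  have "(\<Sum>j\<in>J. A i j * int ((\<beta>(i := n)) j)) = 2 * int n + (\<Sum>j\<in>J - {i}. A i j * int (\<beta> j))"
    using assms by (simp add: sum.remove[of J i])
  moreover have "(\<Sum>j\<in>J. A i j * int (\<beta> j)) = 2 * int (\<beta> i) + (\<Sum>j\<in>J - {i}. A i j * int (\<beta> j))"
    using assms by (simp add: sum.remove[of J i])
  ultimately show ?thesis
    unfolding pairing_def by simp
qed

text \<open>The minimum principle behind the classification of generalized Cartan matrices: on the set where
  \<open>\<gamma> < \<beta>\<close>, subtract from \<open>\<gamma>\<close> the largest multiple of \<open>u = \<beta> - \<gamma>\<close> that leaves it nonnegative, and take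
  \<open>Z\<close> to be the zero set of the result \<open>y\<close>. On \<open>Z\<close> every term of \<open>A y\<close> is nonpositive while \<open>A y\<close> is
  a sum of nonnegative quantities.\<close>

lemma degenerate_subset:
  assumes fin: "finite J"
    and off: "\<And>i j. i \<in> J \<Longrightarrow> j \<in> J \<Longrightarrow> i \<noteq> j \<Longrightarrow> A i j \<le> 0"
    and L: "\<And>i. i \<in> J \<Longrightarrow> 0 \<le> L i"
    and le: "\<And>j. j \<in> J \<Longrightarrow> \<gamma> j \<le> \<beta> j"
    and dom: "\<And>i. i \<in> J \<Longrightarrow> 0 \<le> pairing J A L \<beta> i"
    and ne: "\<exists>j\<in>J. \<gamma> j < \<beta> j"
    and stuck: "\<And>i. i \<in> J \<Longrightarrow> \<gamma> i < \<beta> i \<Longrightarrow> pairing J A L \<gamma> i \<le> 0"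
  shows "\<exists>Z\<subseteq>J. Z \<noteq> {} \<and> (\<forall>i\<in>Z. 0 < \<beta> i \<and> L i = 0) \<and> (\<forall>i\<in>Z. \<forall>j\<in>J - Z. A i j * int (\<beta> j) = 0)"
proof -
  define T where "T = {j\<in>J. \<gamma> j < \<beta> j}"
  define u where "u j = real (\<beta> j) - real (\<gamma> j)" for j
  have T: "T \<subseteq> J" "finite T" "T \<noteq> {}"
    using fin ne by (auto simp: T_def)
  have upos: "0 < u j" if "j \<in> T" for j
    using that by (simp add: T_def u_def)
  have u0: "u j = 0" if "j \<in> J - T" for j
    using that le by (force simp: T_def u_def)
  define t where "t = Min ((\<lambda>j. real (\<gamma> j) / u j) ` T)"
  have "t \<in> (\<lambda>j. real (\<gamma> j) / u j) ` T"
    unfolding t_def using T by (intro Min_in) auto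
  then obtain i0 where i0: "i0 \<in> T" "t = real (\<gamma> i0) / u i0"
    by blast
  have t0: "0 \<le> t"
    using i0 upos[of i0] by simp
  define y where "y j = real (\<gamma> j) - t * u j" for j
  have ynonneg: "0 \<le> y j" if "j \<in> T" for j
  proof -
    have "t \<le> real (\<gamma> j) / u j"
      unfolding t_def using T that by (intro Min_le) auto
    then show ?thesis
      using upos[OF that] by (simp add: y_def field_simps)
  qed
  define Z where "Z = {j\<in>T. y j = 0}"
  have "i0 \<in> Z"
    using i0 upos[of i0] by (simp add: Z_def y_def)
  have key: "L i = 0 \<and> (\<forall>j\<in>J - Z. A i j * int (\<beta> j) = 0)" if i: "i \<in> Z" for i
  proof -
    have iT: "i \<in> T" and iJ: "i \<in> J" and yi: "y i = 0"
      using i T by (auto simp: Z_def)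
    have Ay: "real_of_int (A i j) * y j \<le> 0" if "j \<in> T" for j
    proof (cases "j = i")
      case True
      then show ?thesis using yi by simp
    next
      case False
      then have "A i j \<le> 0"
        using off iJ that T by auto
      then show ?thesis
        using ynonneg[OF that] by (simp add: mult_nonpos_nonneg)
    qed
    have Ag: "real_of_int (A i j) * real (\<gamma> j) \<le> 0" if "j \<in> J - T" for j
    proof -
      have "A i j \<le> 0"
        using off[OF iJ, of j] that iT by blast
      then show ?thesis
        by (simp add: mult_nonpos_nonneg)
    qed
    have splitJ: "(\<Sum>j\<in>J. f j) = (\<Sum>j\<in>T. f j) + (\<Sum>j\<in>J - T. f j)" for f :: "'a \<Rightarrow> real"
      using T fin by (metis sum.subset_diff add.commute)
    have "(\<Sum>j\<in>T. A i j * u j) = (\<Sum>j\<in>J. A i j * u j)"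
      using u0 by (simp add: splitJ)
    also have "\<dots> = real_of_int (pairing J A L \<gamma> i) - real_of_int (pairing J A L \<beta> i)"
      by (simp add: pairing_def u_def algebra_simps sum_subtractf)
    finally have Au: "(\<Sum>j\<in>T. A i j * u j) \<le> 0"
      using dom[OF iJ] stuck[OF iJ] iT by (simp add: T_def)
    have Ay_eq: "(\<Sum>j\<in>T. A i j * y j) = (\<Sum>j\<in>T. A i j * real (\<gamma> j)) - t * (\<Sum>j\<in>T. A i j * u j)"
      by (simp add: y_def sum_subtractf sum_distrib_left algebra_simps)
    have "(\<Sum>j\<in>T. A i j * real (\<gamma> j)) + (\<Sum>j\<in>J - T. A i j * real (\<gamma> j))
        = real_of_int (L i) - real_of_int (pairing J A L \<gamma> i)"
      by (simp add: pairing_def flip: splitJ)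
    moreover have "real_of_int (pairing J A L \<gamma> i) \<le> 0"
      using stuck[OF iJ] iT by (simp add: T_def)
    moreover have "0 \<le> real_of_int (L i)"
      using L[OF iJ] by simp
    moreover have s1: "(\<Sum>j\<in>J - T. A i j * real (\<gamma> j)) \<le> 0"
      using Ag by (intro sum_nonpos) auto
    moreover have s2: "(\<Sum>j\<in>T. A i j * y j) \<le> 0"
      using Ay by (intro sum_nonpos) auto
    moreover have "t * (\<Sum>j\<in>T. A i j * u j) \<le> 0"
      using t0 Au by (simp add: mult_nonneg_nonpos)
    \<comment> \<open>By \<open>Ay_eq\<close>, the sum of \<open>A i j * y j\<close> over
      \<open>T\<close> is \<open>L i\<close>, minus the pairing of \<gamma>, minus the sum over
      \<open>J - T\<close>, minus \<open>t\<close> times the sum with \<open>u\<close>. These four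
      contributions are nonnegative and the total is nonpositive, so everything vanishes.\<close>
    ultimately have *: "real_of_int (L i) = 0" "(\<Sum>j\<in>J - T. A i j * real (\<gamma> j)) = 0"
      "(\<Sum>j\<in>T. A i j * y j) = 0"
      using Ay_eq by linarith+
    have g0: "real_of_int (A i j) * real (\<gamma> j) = 0" if "j \<in> J - T" for j
      using *(2) Ag that fin sum_nonneg_eq_0_iff[of "J - T" "\<lambda>j. - (A i j * real (\<gamma> j))"]
      by (simp add: sum_negf)
    have y0: "real_of_int (A i j) * y j = 0" if "j \<in> T" for j
      using *(3) Ay that T sum_nonneg_eq_0_iff[of T "\<lambda>j. - (A i j * y j)"]
      by (simp add: sum_negf)
    \<comment> \<open>Inside \<open>T\<close> but outside \<open>Z\<close>, \<open>y j\<close> is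
      nonzero and \<open>y0\<close> forces \<open>A i j = 0\<close>; outside \<open>T\<close>,
      \<beta> and \<gamma> agree and \<open>g0\<close> applies.\<close>
    have "A i j * int (\<beta> j) = 0" if j: "j \<in> J - Z" for j
    proof (cases "j \<in> T")
      case True
      then show ?thesis
        using y0[OF True] j by (simp add: Z_def)
    next
      case False
      then have "\<beta> j = \<gamma> j"
        using j le[of j] by (force simp: T_def)
      then show ?thesis
        using g0[of j] j False by simp
    qed
    then show ?thesis
      using * by simp
  qed
  show ?thesis
  proof (intro exI[of _ Z] conjI)
    show "Z \<subseteq> J" using T by (auto simp: Z_def)
    show "Z \<noteq> {}" using \<open>i0 \<in> Z\<close> by blast
    show "\<forall>i\<in>Z. 0 < \<beta> i \<and> L i = 0" using key by (simp add: Z_def T_def)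
    show "\<forall>i\<in>Z. \<forall>j\<in>J - Z. A i j * int (\<beta> j) = 0" using key by blast
  qed
qed

text \<open>After the support condition come the first step of a string, then the simple reflection
  split by the sign of the pairing; the bound in the downward half keeps natural subtraction from
  truncating. The last clause contradicts the conclusion of
  \<open>degenerate_subset\<close>.\<close>

definition weight_slice ::
  "'i set \<Rightarrow> ('i \<Rightarrow> 'i \<Rightarrow> int) \<Rightarrow> ('i \<Rightarrow> int) \<Rightarrow> ('i \<Rightarrow> nat) set \<Rightarrow> bool" where
  "weight_slice J A L Q \<longleftrightarrow>
     (\<forall>\<beta>\<in>Q. \<forall>i. i \<notin> J \<longrightarrow> \<beta> i = 0) \<and>
     (\<forall>\<beta>\<in>Q. \<forall>i\<in>J. 0 < pairing J A L \<beta> i \<longrightarrow> \<beta>(i := Suc (\<beta> i)) \<in> Q) \<and>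
     (\<forall>\<beta>\<in>Q. \<forall>i\<in>J. 0 < pairing J A L \<beta> i \<longrightarrow> \<beta>(i := \<beta> i + nat (pairing J A L \<beta> i)) \<in> Q) \<and>
     (\<forall>\<beta>\<in>Q. \<forall>i\<in>J. pairing J A L \<beta> i < 0 \<longrightarrow>
        nat (- pairing J A L \<beta> i) \<le> \<beta> i \<and> \<beta>(i := \<beta> i - nat (- pairing J A L \<beta> i)) \<in> Q) \<and>
     (\<forall>\<beta>\<in>Q. \<forall>Z\<subseteq>J. Z \<noteq> {} \<longrightarrow> (\<forall>i\<in>Z. 0 < \<beta> i \<and> L i = 0) \<longrightarrow>
        (\<exists>i\<in>Z. \<exists>j\<in>J - Z. A i j * int (\<beta> j) \<noteq> 0))"

text \<open>Induction on the height of \<beta>. A non-dominant \<beta> is reflected to smaller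
  height inside \<open>Q\<close> and reflected back inside \<open>P\<close>. For dominant \<beta>,
  climb in \<open>P\<close> from 0 towards \<beta>; getting stuck would make \<beta> degenerate.
  Used in both directions, this yields uniqueness.\<close>

lemma weight_slice_subset:
  assumes fin: "finite J"
    and diag: "\<And>i. i \<in> J \<Longrightarrow> A i i = 2"
    and off: "\<And>i j. i \<in> J \<Longrightarrow> j \<in> J \<Longrightarrow> i \<noteq> j \<Longrightarrow> A i j \<le> 0"
    and L: "\<And>i. i \<in> J \<Longrightarrow> 0 \<le> L i"
    and Q: "weight_slice J A L Q"
    and P: "weight_slice J A L P"
    and zero: "(\<lambda>_. 0) \<in> P"
  shows "Q \<subseteq> P"
proof
  fix \<beta> assume "\<beta> \<in> Q"
  then show "\<beta> \<in> P"
  proof (induction "\<Sum>j\<in>J. \<beta> j" arbitrary: \<beta> rule: less_induct)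
    case less
    show ?case
    proof (cases "\<exists>i\<in>J. pairing J A L \<beta> i < 0")
      case True
      then obtain i where i: "i \<in> J" "pairing J A L \<beta> i < 0" by blast
      define k where "k = nat (- pairing J A L \<beta> i)"
      define \<beta>' where "\<beta>' = \<beta>(i := \<beta> i - k)"
      have k: "0 < k" "k \<le> \<beta> i" "\<beta>' \<in> Q"
        using i Q less.prems unfolding weight_slice_def k_def \<beta>'_def by auto
      have "(\<Sum>j\<in>J. \<beta>' j) < (\<Sum>j\<in>J. \<beta> j)"
        using k i fin by (intro sum_strict_mono_ex1) (auto simp: \<beta>'_def)
      then have "\<beta>' \<in> P"
        using less.hyps k by blast
      \<comment> \<open>The reflection flips the sign of the pairing, so reflecting \<beta>' upwards
        within \<open>P\<close> restores \<beta>.\<close>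
      moreover have "pairing J A L \<beta>' i = int k"
        using i k diag[of i] fin by (simp add: \<beta>'_def pairing_update k_def of_nat_diff)
      ultimately have "\<beta>'(i := \<beta>' i + k) \<in> P"
        using P i k unfolding weight_slice_def by (metis nat_int of_nat_0_less_iff)
      then show ?thesis
        using k by (simp add: \<beta>'_def)
    next
      case False
      then have dom: "0 \<le> pairing J A L \<beta> i" if "i \<in> J" for i
        using that by force
      \<comment> \<open>A member of greatest height is the end of a climb in \<open>P\<close> below
        \<beta>: where it is still short of \<beta>, a positive pairing would allow one more
        step.\<close>
      define \<Psi> where "\<Psi> = {\<gamma>\<in>P. \<forall>j. \<gamma> j \<le> \<beta> j}"
      have "\<exists>\<gamma>. \<gamma> \<in> \<Psi> \<and> (\<forall>\<gamma>'. \<gamma>' \<in> \<Psi> \<longrightarrow> (\<Sum>j\<in>J. \<gamma>' j) \<le> (\<Sum>j\<in>J. \<gamma> j))"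
        by (rule ex_has_greatest_nat[where k = "\<lambda>_. 0" and b = "Suc (\<Sum>j\<in>J. \<beta> j)"])
          (use zero in \<open>auto simp: \<Psi>_def less_Suc_eq_le intro: sum_mono\<close>)
      then obtain \<gamma> where \<gamma>: "\<gamma> \<in> \<Psi>" and max: "\<And>\<gamma>'. \<gamma>' \<in> \<Psi> \<Longrightarrow> (\<Sum>j\<in>J. \<gamma>' j) \<le> (\<Sum>j\<in>J. \<gamma> j)"
        by blast
      have stuck: "pairing J A L \<gamma> i \<le> 0" if i: "i \<in> J" "\<gamma> i < \<beta> i" for i
      proof (rule ccontr)
        assume "\<not> pairing J A L \<gamma> i \<le> 0"
        then have "\<gamma>(i := Suc (\<gamma> i)) \<in> \<Psi>"
          using \<gamma> P i unfolding weight_slice_def \<Psi>_def by auto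
        moreover have "(\<Sum>j\<in>J. \<gamma> j) < (\<Sum>j\<in>J. (\<gamma>(i := Suc (\<gamma> i))) j)"
          using i fin by (intro sum_strict_mono_ex1) auto
        ultimately show False
          using max by force
      qed
      have "\<not> (\<exists>j\<in>J. \<gamma> j < \<beta> j)"
      proof
        assume ne: "\<exists>j\<in>J. \<gamma> j < \<beta> j"
        have le: "\<gamma> j \<le> \<beta> j" if "j \<in> J" for j
          using \<gamma> by (simp add: \<Psi>_def)
        have "\<exists>Z\<subseteq>J. Z \<noteq> {} \<and> (\<forall>i\<in>Z. 0 < \<beta> i \<and> L i = 0) \<and>
            (\<forall>i\<in>Z. \<forall>j\<in>J - Z. A i j * int (\<beta> j) = 0)"
          by (rule degenerate_subset[where \<gamma> = \<gamma>]) (use fin off L le dom ne stuck in auto)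
        moreover have "\<forall>Z\<subseteq>J. Z \<noteq> {} \<longrightarrow> (\<forall>i\<in>Z. 0 < \<beta> i \<and> L i = 0) \<longrightarrow>
            (\<exists>i\<in>Z. \<exists>j\<in>J - Z. A i j * int (\<beta> j) \<noteq> 0)"
          using Q less.prems unfolding weight_slice_def by blast
        ultimately show False
          by blast
      qed
      moreover have "\<beta> j = 0" "\<gamma> j = 0" if "j \<notin> J" for j
        using that Q P less.prems \<gamma> unfolding weight_slice_def \<Psi>_def by blast+
      ultimately have "\<gamma> = \<beta>"
        using \<gamma> unfolding \<Psi>_def fun_eq_iff by (metis (mono_tags) leI le_antisym mem_Collect_eq)
      then show ?thesis
        using \<gamma> by (simp add: \<Psi>_def)
    qed
  qed
qed

section \<open>Operators on a subspace and sl2\<close>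

locale subspace_ops = vector_space scale
  for scale :: "complex \<Rightarrow> 'v::ab_group_add \<Rightarrow> 'v" (infixr \<open>*s\<close> 75) +
  fixes V :: "'v set"
  assumes subspace_V: "subspace V"
begin

text \<open>Linearity is asked on \<open>V\<close> only, because a module action is unspecified off
  the carrier.\<close>

definition endo :: "('v \<Rightarrow> 'v) \<Rightarrow> bool" where
  "endo X \<longleftrightarrow> (\<forall>v\<in>V. X v \<in> V) \<and> (\<forall>v\<in>V. \<forall>w\<in>V. X (v + w) = X v + X w) \<and>
     (\<forall>c. \<forall>v\<in>V. X (c *s v) = c *s X v)"

lemma endoD:
  assumes "endo X"
  shows "v \<in> V \<Longrightarrow> X v \<in> V"
    and "v \<in> V \<Longrightarrow> w \<in> V \<Longrightarrow> X (v + w) = X v + X w"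
    and "v \<in> V \<Longrightarrow> X (c *s v) = c *s X v"
  using assms by (auto simp: endo_def)

lemmas V_closed = subspace_0[OF subspace_V] subspace_add[OF subspace_V]
  subspace_diff[OF subspace_V] subspace_scale[OF subspace_V] subspace_neg[OF subspace_V]

lemma endo_zero: "endo X \<Longrightarrow> X 0 = 0"
  using endoD(3)[of X 0 0] V_closed by simp

lemma endo_uminus: "endo X \<Longrightarrow> v \<in> V \<Longrightarrow> X (- v) = - X v"
  using endoD(3)[of X v "-1"] by simp

lemma endo_sum:
  assumes "endo X" "\<And>a. a \<in> S \<Longrightarrow> f a \<in> V"
  shows "X (\<Sum>a\<in>S. f a) = (\<Sum>a\<in>S. X (f a))"
  using assms(2)
proof (induction S rule: infinite_finite_induct)
  case (insert a S)
  then show ?case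
    using endoD(2)[OF assms(1), of "f a" "sum f S"] subspace_sum[OF subspace_V, of S f] by simp
qed (simp_all add: endo_zero assms(1))

lemma endo_funpow: "endo X \<Longrightarrow> endo (X ^^ n)"
proof (induction n)
  case 0
  then show ?case by (simp add: endo_def)
next
  case (Suc n)
  then show ?case by (simp add: endo_def)
qed

definition op_bracket :: "('v \<Rightarrow> 'v) \<Rightarrow> ('v \<Rightarrow> 'v) \<Rightarrow> 'v \<Rightarrow> 'v" where
  "op_bracket X Y = (\<lambda>v. X (Y v) - Y (X v))"

lemma endo_op_bracket: "endo X \<Longrightarrow> endo Y \<Longrightarrow> endo (op_bracket X Y)"
  by (auto simp: endo_def op_bracket_def V_closed algebra_simps scale_right_diff_distrib)

text \<open>Write \<open>X Y = [X, Y] + Y X\<close> and induct on \<open>n + k\<close>: the first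
  summand lowers the ad-nilpotency order \<open>k\<close>, the second lowers the order
  \<open>n\<close> of the vector. If either order is 0, then \<open>Y w = 0\<close> already.\<close>

lemma nilpotent_commute:
  assumes X: "endo X" and Y: "endo Y" and ad: "\<forall>v\<in>V. (op_bracket X ^^ k) Y v = 0"
    and w: "w \<in> V" "(X ^^ n) w = 0"
  shows "(X ^^ (n + k)) (Y w) = 0"
  using Y ad w
proof (induction m \<equiv> "n + k" arbitrary: n k Y w)
  case 0
  then have "k = 0" by simp
  then show ?case
    using 0 by simp
next
  case (Suc m)
  note X0 = endo_zero[OF endo_funpow[OF X]]
  have in_V: "op_bracket X Y w \<in> V" "Y (X w) \<in> V" "X w \<in> V"
    using endoD(1)[OF endo_op_bracket[OF X Suc.prems(1)] Suc.prems(3)] endoD(1)[OF X Suc.prems(3)]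
      endoD(1)[OF Suc.prems(1)] by blast+
  consider "k = 0" | "n = 0" | k' n' where "k = Suc k'" "n = Suc n'"
    by (meson not0_implies_Suc)
  then show ?case
  proof cases
    case 1
    then show ?thesis
      using Suc.prems X0 by simp
  next
    case 2
    then show ?thesis
      using Suc.prems X0 endo_zero[OF Suc.prems(1)] by simp
  next
    case 3
    have "(X ^^ (n + k')) (op_bracket X Y w) = 0"
    proof (rule Suc.hyps(1)[where n = n and k = k' and Y = "op_bracket X Y" and w = w])
      show "\<forall>v\<in>V. (op_bracket X ^^ k') (op_bracket X Y) v = 0"
        using Suc.prems(2) unfolding 3 by (simp add: funpow_swap1)
    qed (use Suc 3 X endo_op_bracket in auto)
    moreover have "(X ^^ (n' + k)) (Y (X w)) = 0"
    proof (rule Suc.hyps(1)[where n = n' and k = k and Y = Y and w = "X w"])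
      show "(X ^^ n') (X w) = 0"
        using Suc.prems(4) unfolding 3 by (simp add: funpow_swap1)
    qed (use Suc.prems Suc.hyps(2) 3 in_V in auto)
    moreover have "(X ^^ (n + k)) (Y w) = (X ^^ (n + k')) (op_bracket X Y w + Y (X w))"
      by (simp add: 3 op_bracket_def funpow_swap1)
    ultimately show ?thesis
      using endoD(2)[OF endo_funpow[OF X] in_V(1,2), of "n + k'"] by (simp add: 3)
  qed
qed

section \<open>Commutation identities and nonvanishing of reflections for sl2\<close>

lemma sl2_weight_funpow:
  assumes f: "endo f" and h: "endo h"
    and hf: "\<forall>v\<in>V. h (f v) = f (h v) - 2 *s f v"
    and u: "u \<in> V" "h u = c *s u"
  shows "h ((f ^^ m) u) = (c - 2 * of_nat m) *s (f ^^ m) u"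
proof (induction m)
  case 0
  then show ?case using u by simp
next
  case (Suc m)
  have "(f ^^ m) u \<in> V"
    using endoD(1)[OF endo_funpow[OF f] u(1)] .
  then show ?case
    using hf Suc by (simp add: endoD(3)[OF f] flip: scale_left_diff_distrib)
qed

text \<open>The identity \<open>[e, f^(m+1)] = (m+1) f^m (h - m)\<close> on an eigenvector of
  \<open>h\<close>. The term in \<open>e u\<close> is kept because \<open>sl2_reflection\<close>
  needs vectors that \<open>e\<close> does not yet kill.\<close>

lemma sl2_commute_funpow:
  assumes e: "endo e" and f: "endo f" and h: "endo h"
    and ef: "\<forall>v\<in>V. e (f v) = f (e v) + h v"
    and hf: "\<forall>v\<in>V. h (f v) = f (h v) - 2 *s f v"
    and u: "u \<in> V" "h u = c *s u"
  shows "e ((f ^^ Suc m) u) =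
    (f ^^ Suc m) (e u) + (of_nat (Suc m) * (c - of_nat m)) *s (f ^^ m) u"
proof (induction m)
  case 0
  then show ?case using u ef by simp
next
  case (Suc m)
  have in_V: "(f ^^ n) u \<in> V" "(f ^^ n) (e u) \<in> V" for n
    using endoD(1)[OF endo_funpow[OF f]] u endoD(1)[OF e] by blast+
  have hw: "h ((f ^^ Suc m) u) = (c - 2 * of_nat (Suc m)) *s (f ^^ Suc m) u"
    by (rule sl2_weight_funpow[OF f h hf u])
  have "e ((f ^^ Suc (Suc m)) u) = f (e ((f ^^ Suc m) u)) + h ((f ^^ Suc m) u)"
    using ef in_V(1)[of "Suc m"] by simp
  also have "\<dots> = (f ^^ Suc (Suc m)) (e u) + ((of_nat (Suc m) * (c - of_nat m)) *s (f ^^ Suc m) u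
      + (c - 2 * of_nat (Suc m)) *s (f ^^ Suc m) u)"
    unfolding Suc.IH hw
    using endoD(2)[OF f in_V(2)[of "Suc m"] V_closed(4)[OF in_V(1)[of m]]]
    by (simp add: endoD(3)[OF f in_V(1)[of m]] add.assoc)
  also have "\<dots> = (f ^^ Suc (Suc m)) (e u) + (of_nat (Suc (Suc m)) * (c - of_nat (Suc m))) *s (f ^^ Suc m) u"
    unfolding scale_left_distrib[symmetric] by (simp add: algebra_simps)
  finally show ?case .
qed

text \<open>Only \<open>e\<close> has to be nilpotent on \<open>u\<close>: applying \<open>e\<close> raises \<open>k\<close> by 2 and preserves the hypotheses,
  which reduces to the case of a highest weight vector.\<close>

lemma sl2_reflection:
  assumes e: "endo e" and f: "endo f" and h: "endo h"
    and ef: "\<forall>v\<in>V. e (f v) = f (e v) + h v"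
    and he: "\<forall>v\<in>V. h (e v) = e (h v) + 2 *s e v"
    and hf: "\<forall>v\<in>V. h (f v) = f (h v) - 2 *s f v"
    and "u \<in> V" "h u = of_nat k *s u" "(e ^^ n) u = 0" "(f ^^ k) u = 0"
  shows "u = 0"
  using assms(7-10)
proof (induction n arbitrary: u k)
  case 0
  then show ?case by simp
next
  case (Suc n)
  note u = Suc.prems(1,2)
  have vanish: "(f ^^ (k + j)) u = 0" for j
    using Suc.prems(4) endo_zero[OF endo_funpow[OF f]] by (metis funpow_add comp_apply add.commute)
  have eu: "e u = 0"
  proof (rule Suc.IH)
    show "e u \<in> V" by (rule endoD(1)[OF e u(1)])
    show "h (e u) = of_nat (k + 2) *s e u"
      using he u by (simp add: endoD(3)[OF e] scale_left_distrib)
    show "(e ^^ n) (e u) = 0"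
      using Suc.prems(3) by (simp add: funpow_swap1)
    \<comment> \<open>In the commutation identity with \<open>m = k + 1\<close>, both
      \<open>f^(k+2) u\<close> and \<open>f^(k+1) u\<close> vanish, which leaves only this
      term.\<close>
    show "(f ^^ (k + 2)) (e u) = 0"
      using sl2_commute_funpow[OF e f h ef hf u, of "Suc k"] vanish[of 1] vanish[of 2] endo_zero[OF e]
      by simp
  qed
  \<comment> \<open>Since \<open>e u = 0\<close>, applying \<open>e\<close> to
    \<open>f^(m+1) u\<close> gives \<open>(m+1)(k-m) f^m u\<close>. The scalar is nonzero for
    \<open>m < k\<close>, so vanishing descends from \<open>f^k u\<close> to
    \<open>u\<close>.\<close>
  have "j \<le> k \<Longrightarrow> (f ^^ (k - j)) u = 0" for j
  proof (induction j)
    case 0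
    then show ?case using Suc.prems by simp
  next
    case (Suc j)
    define m where "m = k - Suc j"
    have m: "k - j = Suc m" "m < k"
      using Suc.prems by (auto simp: m_def)
    have "0 = (of_nat (Suc m) * (of_nat k - of_nat m)) *s (f ^^ m) u"
      using sl2_commute_funpow[OF e f h ef hf u, of m] Suc m eu
        endo_zero[OF e] endo_zero[OF endo_funpow[OF f]] by (metis Suc_leD add_0)
    moreover have "of_nat (Suc m) * (of_nat k - of_nat m) \<noteq> (0 :: complex)"
      using m by (simp del: of_nat_Suc)
    ultimately show ?case
      by (simp add: m_def)
  qed
  from this[of k] show ?case by simp
qed

end

section \<open>Irreducible highest weight representations\<close>

lemma vector_space_fun_scale: "vector_space fun_scale"
  by unfold_locales (auto simp: fun_scale_def fun_eq_iff algebra_simps)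

lemma realization_gcm:
  assumes "realization D"
  shows "finite (index_set D)"
    and "i \<in> index_set D \<Longrightarrow> cartan D i i = 2"
    and "i \<in> index_set D \<Longrightarrow> j \<in> index_set D \<Longrightarrow> i \<noteq> j \<Longrightarrow> cartan D i j \<le> 0"
    and "i \<in> index_set D \<Longrightarrow> j \<in> index_set D \<Longrightarrow>
      simple_root D j (simple_coroot D i) = of_int (cartan D i j)"
    and "i \<in> index_set D \<Longrightarrow> simple_root D i \<in> hdual D"
    and "inj_on (simple_root D) (index_set D)"
  using assms unfolding realization_def gcm_def lin_indep_family_def by blast+

text \<open>Passes from linear relations between functions to their values at a point, as
  \<open>simple_roots_independent\<close> requires.\<close>

lemma sum_fun_apply: "(\<Sum>a\<in>S. f a) x = (\<Sum>a\<in>S. f a x)"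
  for f :: "'a \<Rightarrow> 'b \<Rightarrow> 'c::comm_monoid_add"
  by (induction S rule: infinite_finite_induct) auto

lemma simple_roots_independent:
  assumes D: "realization D" and c: "\<And>h. (\<Sum>i\<in>index_set D. c i * simple_root D i h) = 0"
    and i: "i \<in> index_set D"
  shows "c i = 0"
proof -
  interpret vector_space fun_scale by (rule vector_space_fun_scale)
  let ?I = "index_set D" and ?r = "simple_root D"
  have inj: "inj_on ?r ?I" and ind: "independent (?r ` ?I)" and fin: "finite ?I"
    using D unfolding realization_def gcm_def lin_indep_family_def by auto
  have "(\<Sum>v\<in>?r ` ?I. fun_scale (c (inv_into ?I ?r v)) v) = (\<Sum>i\<in>?I. fun_scale (c i) (?r i))"
    using inj by (simp add: sum.reindex)
  also have "\<dots> = 0"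
    using c by (simp add: fun_eq_iff sum_fun_apply fun_scale_def)
  finally have "c (inv_into ?I ?r (?r i)) = 0"
    using independentD[OF ind, of "?r ` ?I" "\<lambda>v. c (inv_into ?I ?r v)" "?r i"] fin i by simp
  then show ?thesis
    using inj i by simp
qed

text \<open>The action of the Levi subalgebra \<open>l\<^sub>K\<close> on a simple highest weight module, seen through the
  generators only; \<open>K = index_set D\<close> covers the whole algebra.\<close>

locale km_rep = subspace_ops scale V
  for scale :: "complex \<Rightarrow> 'v::ab_group_add \<Rightarrow> 'v" (infixr \<open>*s\<close> 75) and V +
  fixes D :: "('h::ab_group_add, 'i) km_datum" and K :: "'i set"
    and E F :: "'i \<Rightarrow> 'v \<Rightarrow> 'v" and H :: "'h \<Rightarrow> 'v \<Rightarrow> 'v"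
    and \<Lambda> :: "'h \<Rightarrow> complex" and v0 :: 'v
  assumes D: "realization D" and K: "K \<subseteq> index_set D"
    and E: "i \<in> K \<Longrightarrow> endo (E i)" and F: "i \<in> K \<Longrightarrow> endo (F i)" and H: "endo (H h)"
    and HE: "i \<in> K \<Longrightarrow> v \<in> V \<Longrightarrow> H h (E i v) = E i (H h v) + simple_root D i h *s E i v"
    and HF: "i \<in> K \<Longrightarrow> v \<in> V \<Longrightarrow> H h (F i v) = F i (H h v) - simple_root D i h *s F i v"
    and EF_same: "i \<in> K \<Longrightarrow> v \<in> V \<Longrightarrow> E i (F i v) = F i (E i v) + H (simple_coroot D i) v"
    and EF_diff: "i \<in> K \<Longrightarrow> j \<in> K \<Longrightarrow> i \<noteq> j \<Longrightarrow> v \<in> V \<Longrightarrow> E i (F j v) = F j (E i v)"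
    and serre: "i \<in> K \<Longrightarrow> j \<in> K \<Longrightarrow> i \<noteq> j \<Longrightarrow> v \<in> V \<Longrightarrow>
      (op_bracket (F i) ^^ nat (1 - cartan D i j)) (F j) v = 0"
    and v0: "v0 \<in> V" "v0 \<noteq> 0" and H_v0: "H h v0 = \<Lambda> h *s v0"
    and E_v0: "i \<in> K \<Longrightarrow> E i v0 = 0"
    and irreducible: "subspace U \<Longrightarrow> U \<subseteq> V \<Longrightarrow> (\<And>i u. i \<in> K \<Longrightarrow> u \<in> U \<Longrightarrow> E i u \<in> U) \<Longrightarrow>
      (\<And>i u. i \<in> K \<Longrightarrow> u \<in> U \<Longrightarrow> F i u \<in> U) \<Longrightarrow> (\<And>h u. u \<in> U \<Longrightarrow> H h u \<in> U) \<Longrightarrow>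
      U = {0} \<or> U = V"
begin

abbreviation "I \<equiv> index_set D"
abbreviation "\<alpha> \<equiv> simple_root D"
abbreviation "\<alpha>c \<equiv> simple_coroot D"
abbreviation "A \<equiv> cartan D"

lemmas gcm = realization_gcm[OF D]

lemma K_in_I: "i \<in> K \<Longrightarrow> i \<in> I"
  using K by blast

lemma root_coroot_same: "i \<in> K \<Longrightarrow> \<alpha> i (\<alpha>c i) = 2"
  using gcm(2,4)[of i] K by force

section \<open>Weight vectors and independence of weight spaces\<close>

definition wvec :: "('h \<Rightarrow> complex) \<Rightarrow> 'v set" where
  "wvec \<chi> = {m\<in>V. \<forall>h. H h m = \<chi> h *s m}"

lemma wvec_V: "m \<in> wvec \<chi> \<Longrightarrow> m \<in> V"
  by (simp add: wvec_def)

lemma wvec_zero: "0 \<in> wvec \<chi>"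
  using endo_zero[OF H] V_closed by (simp add: wvec_def)

lemma subspace_wvec: "subspace (wvec \<chi>)"
  by (rule subspaceI)
    (auto simp: wvec_def V_closed endoD(2)[OF H] endoD(3)[OF H] endo_zero[OF H]
      scale_right_distrib mult.commute)

lemma v0_wvec: "v0 \<in> wvec \<Lambda>"
  using v0 H_v0 by (simp add: wvec_def)

lemma wvec_unique:
  assumes "m \<in> wvec \<chi>" "m \<in> wvec \<psi>" "m \<noteq> 0"
  shows "\<chi> = \<psi>"
  using assms by (auto simp: wvec_def fun_eq_iff)

lemma wvec_F: "i \<in> K \<Longrightarrow> m \<in> wvec \<chi> \<Longrightarrow> F i m \<in> wvec (\<lambda>h. \<chi> h - \<alpha> i h)"
  by (auto simp: wvec_def endoD(1)[OF F] HF endoD(3)[OF F] scale_left_diff_distrib)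

lemma wvec_E: "i \<in> K \<Longrightarrow> m \<in> wvec \<chi> \<Longrightarrow> E i m \<in> wvec (\<lambda>h. \<chi> h + \<alpha> i h)"
  by (auto simp: wvec_def endoD(1)[OF E] HE endoD(3)[OF E] scale_left_distrib)

lemma wvec_F_funpow:
  "i \<in> K \<Longrightarrow> m \<in> wvec \<chi> \<Longrightarrow> (F i ^^ k) m \<in> wvec (\<lambda>h. \<chi> h - of_nat k * \<alpha> i h)"
proof (induction k)
  case (Suc k)
  then show ?case
    using wvec_F[of i "(F i ^^ k) m" "\<lambda>h. \<chi> h - of_nat k * \<alpha> i h"] by (simp add: algebra_simps)
qed simp

lemma wvec_E_funpow:
  "i \<in> K \<Longrightarrow> m \<in> wvec \<chi> \<Longrightarrow> (E i ^^ k) m \<in> wvec (\<lambda>h. \<chi> h + of_nat k * \<alpha> i h)"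
proof (induction k)
  case (Suc k)
  then show ?case
    using wvec_E[of i "(E i ^^ k) m" "\<lambda>h. \<chi> h + of_nat k * \<alpha> i h"] by (simp add: algebra_simps)
qed simp

lemma wvec_word:
  "set ws \<subseteq> K \<Longrightarrow> m \<in> wvec \<chi> \<Longrightarrow>
    foldr F ws m \<in> wvec (\<lambda>h. \<chi> h - (\<Sum>i\<in>I. of_nat (count_list ws i) * \<alpha> i h))"
proof (induction ws)
  case (Cons a ws)
  have "(\<Sum>i\<in>I. of_nat (count_list (a # ws) i) * \<alpha> i h)
      = (\<Sum>i\<in>I. (if a = i then \<alpha> i h else 0) + of_nat (count_list ws i) * \<alpha> i h)" for h
    by (rule sum.cong) (auto simp: algebra_simps)
  also have "\<dots> h = \<alpha> a h + (\<Sum>i\<in>I. of_nat (count_list ws i) * \<alpha> i h)" for h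
    using Cons.prems K by (subst sum.distrib) (auto simp: gcm(1))
  finally have eq: "\<chi> h - (\<Sum>i\<in>I. of_nat (count_list (a # ws) i) * \<alpha> i h)
      = \<chi> h - (\<Sum>i\<in>I. of_nat (count_list ws i) * \<alpha> i h) - \<alpha> a h" for h
    by simp
  show ?case
    unfolding eq using Cons.prems wvec_F[OF _ Cons.IH, of a] by simp
qed simp

text \<open>Applying \<open>H h - \<psi> h\<close> to the relation removes the \<psi>-term and
  multiplies each other term by \<open>\<phi> h - \<psi> h\<close>. The induction hypothesis kills
  these multiples, and some \<open>h\<close> separates \<phi> from \<psi>.\<close>

lemma weight_spaces_independent:
  assumes "finite X" "\<And>\<chi>. \<chi> \<in> X \<Longrightarrow> m \<chi> \<in> wvec \<chi>" "(\<Sum>\<chi>\<in>X. m \<chi>) = 0"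
    and "\<chi> \<in> X"
  shows "m \<chi> = 0"
  using assms
proof (induction X arbitrary: m \<chi> rule: finite_induct)
  case (insert \<psi> X)
  have eig: "H h (m \<phi>) = \<phi> h *s m \<phi>" if "\<phi> \<in> insert \<psi> X" for h \<phi>
    using insert.prems(1)[OF that] by (simp add: wvec_def)
  have zero: "m \<phi> = 0" if \<phi>: "\<phi> \<in> X" for \<phi>
  proof -
    have "(\<phi> h - \<psi> h) *s m \<phi> = 0" for h
    proof (rule insert.IH[where m = "\<lambda>\<phi>. (\<phi> h - \<psi> h) *s m \<phi>"])
      show "(\<phi> h - \<psi> h) *s m \<phi> \<in> wvec \<phi>" if "\<phi> \<in> X" for \<phi>
        using insert.prems(1) that subspace_scale[OF subspace_wvec] by blast
      have "0 = H h (\<Sum>\<chi>\<in>insert \<psi> X. m \<chi>) - \<psi> h *s (\<Sum>\<chi>\<in>insert \<psi> X. m \<chi>)"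
        using insert.prems(2) endo_zero[OF H] by simp
      also have "\<dots> = (\<Sum>\<chi>\<in>insert \<psi> X. (\<chi> h - \<psi> h) *s m \<chi>)"
        using insert.prems(1) wvec_V
        by (subst endo_sum[OF H])
          (auto simp: eig scale_sum_right scale_left_diff_distrib sum_subtractf simp del: sum.insert)
      also have "\<dots> = (\<Sum>\<chi>\<in>X. (\<chi> h - \<psi> h) *s m \<chi>)"
        using insert.hyps by simp
      finally show "(\<Sum>\<chi>\<in>X. (\<chi> h - \<psi> h) *s m \<chi>) = 0" by simp
    qed (rule \<phi>)
    moreover obtain h where "\<phi> h \<noteq> \<psi> h"
      using \<phi> insert.hyps by (metis ext)
    ultimately show ?thesis by (metis eq_iff_diff_eq_0 scale_eq_0_iff)
  qed
  then have "m \<psi> = 0"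
    using insert.prems(2) insert.hyps by simp
  then show ?case
    using zero insert.prems(3) by blast
qed simp

text \<open>Group a linear combination for \<open>m\<close> by weight and compare the components at
  \<chi>: that component equals \<open>m\<close>, so a generator of weight \<chi> must
  contribute.\<close>

lemma weight_in_span:
  assumes B: "\<And>b. b \<in> B \<Longrightarrow> \<exists>\<psi>. b \<in> wvec \<psi>"
    and m: "m \<in> span B" "m \<in> wvec \<chi>" "m \<noteq> 0"
  obtains b where "b \<in> B" "b \<noteq> 0" "b \<in> wvec \<chi>"
proof -
  obtain \<omega> where \<omega>: "\<And>b. b \<in> B \<Longrightarrow> b \<in> wvec (\<omega> b)"
    using B by metis
  obtain t r where t: "finite t" "t \<subseteq> B" "m = (\<Sum>b\<in>t. r b *s b)"
    using m(1) by (auto simp: span_explicit)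
  \<comment> \<open>\<chi> is inserted so that \<open>m\<close> can be subtracted in its component
    even before a generator of that weight is known.\<close>
  define X where "X = insert \<chi> (\<omega> ` t)"
  define c where "c \<psi> = (\<Sum>b\<in>{b\<in>t. \<omega> b = \<psi>}. r b *s b)" for \<psi>
  have c: "c \<psi> \<in> wvec \<psi>" for \<psi>
    unfolding c_def using \<omega> t
    by (intro subspace_sum[OF subspace_wvec] subspace_scale[OF subspace_wvec]) auto
  have X: "finite X" using t by (simp add: X_def)
  have "(\<Sum>\<psi>\<in>X. c \<psi>) = m"
    unfolding c_def t(3) using t X by (intro sum.group) (auto simp: X_def)
  then have "(\<Sum>\<psi>\<in>X. c \<psi> - (if \<psi> = \<chi> then m else 0)) = 0"
    using X by (simp add: sum_subtractf X_def)
  then have "c \<chi> - (if \<chi> = \<chi> then m else 0) = 0"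
    by (rule weight_spaces_independent[OF X, rotated])
      (use c m(2) subspace_diff[OF subspace_wvec] in \<open>auto simp: X_def\<close>)
  then have "c \<chi> \<noteq> 0"
    using m by simp
  then obtain b where "b \<in> t" "\<omega> b = \<chi>" "r b *s b \<noteq> 0"
    unfolding c_def by (metis (mono_tags, lifting) mem_Collect_eq sum.neutral)
  then show thesis
    using that[of b] \<omega>[of b] t by auto
qed

lemma endo_span:
  assumes "endo X" "B \<subseteq> V" "\<And>b. b \<in> B \<Longrightarrow> X b \<in> span B" "m \<in> span B"
  shows "X m \<in> span B"
proof -
  \<comment> \<open>Membership in \<open>V\<close> is carried along because \<open>X\<close> is
    linear only there.\<close>
  have "m \<in> V \<and> X m \<in> span B"
    using assms(4)
  proof (induction rule: span_induct_alt)
    case base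
    then show ?case using endo_zero[OF assms(1)] V_closed span_zero by simp
  next
    case (step c x y)
    then have "x \<in> V" using assms(2) by blast
    then show ?case
      using step assms(3)[OF step(1)]
      by (simp add: V_closed endoD(2)[OF assms(1)] endoD(3)[OF assms(1)] span_add span_scale)
  qed
  then show ?thesis by simp
qed

section \<open>Words in the lowering operators and singular vectors\<close>

definition words :: "'v \<Rightarrow> 'v set" where
  "words u = {foldr F ws u |ws. set ws \<subseteq> K}"

lemma words_V:
  assumes "u \<in> V"
  shows "words u \<subseteq> V"
proof -
  have "set ws \<subseteq> K \<Longrightarrow> foldr F ws u \<in> V" for ws
    by (induction ws) (auto simp: assms intro: endoD(1)[OF F])
  then show ?thesis by (auto simp: words_def)
qed

lemma words_weight:
  assumes "u \<in> wvec \<chi>" "b \<in> words u"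
  shows "\<exists>\<psi>. b \<in> wvec \<psi>"
proof -
  obtain ws where ws: "b = foldr F ws u" "set ws \<subseteq> K"
    using assms(2) by (auto simp: words_def)
  show ?thesis
    using wvec_word[OF ws(2) assms(1)] unfolding ws(1) by (rule exI[where P = "\<lambda>\<psi>. foldr F ws u \<in> wvec \<psi>"])
qed

text \<open>The span of the words is stable under \<open>F\<close> by prefixing letters, under
  \<open>H\<close> because words are weight vectors, and under \<open>E\<close> by moving
  \<open>E i\<close> past the letters until it kills \<open>u\<close>. Irreducibility then leaves
  only \<open>V\<close>.\<close>

lemma singular_vector_generates:
  assumes u: "u \<in> wvec \<chi>" "u \<noteq> 0" and sing: "\<And>i. i \<in> K \<Longrightarrow> E i u = 0"
  shows "span (words u) = V"
proof -
  have B: "words u \<subseteq> V"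
    using words_V wvec_V u by blast
  have Fs: "F i m \<in> span (words u)" if "i \<in> K" "m \<in> span (words u)" for i m
  proof (rule endo_span[OF F B _ that(2)])
    fix b assume "b \<in> words u"
    then obtain ws where "b = foldr F ws u" "set ws \<subseteq> K" by (auto simp: words_def)
    then have "F i b = foldr F (i # ws) u" "set (i # ws) \<subseteq> K" using that by auto
    then show "F i b \<in> span (words u)" unfolding words_def by (blast intro: span_base)
  qed (rule that)
  have Hw: "H h b \<in> span (words u)" if "b \<in> words u" for h b
  proof -
    obtain \<psi> where "b \<in> wvec \<psi>"
      using words_weight[OF u(1) \<open>b \<in> words u\<close>] ..
    then show ?thesis
      using span_base[OF that] by (simp add: wvec_def span_scale)
  qed
  have Ew: "E i (foldr F ws u) \<in> span (words u)" if "i \<in> K" "set ws \<subseteq> K" for i ws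
    using that(2)
  proof (induction ws)
    case Nil
    then show ?case using sing[OF that(1)] span_zero by simp
  next
    case (Cons a ws)
    define w where "w = foldr F ws u"
    have w: "w \<in> words u" using Cons.prems by (auto simp: words_def w_def)
    have FE: "F a (E i w) \<in> span (words u)"
      using Fs Cons by (simp add: w_def)
    show ?case
    proof (cases "i = a")
      case True
      then show ?thesis
        using FE Hw[OF w] w B that(1) EF_same[of i w] by (auto simp: span_add simp flip: w_def)
    next
      case False
      then show ?thesis
        using FE w B that(1) Cons.prems EF_diff[of i a w] by (auto simp flip: w_def)
    qed
  qed
  have "span (words u) = {0} \<or> span (words u) = V"
  proof (rule irreducible)
    show "span (words u) \<subseteq> V" using B subspace_V by (rule span_minimal)
    show "E i m \<in> span (words u)" if "i \<in> K" "m \<in> span (words u)" for i m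
      by (rule endo_span[OF E B _ that(2)]) (use Ew that in \<open>auto simp: words_def\<close>)
    show "H h m \<in> span (words u)" if "m \<in> span (words u)" for h m
      by (rule endo_span[OF H B _ that]) (rule Hw)
  qed (use Fs in auto)
  moreover have "u \<in> span (words u)"
    by (rule span_base) (auto simp: words_def intro!: exI[of _ "[]"])
  ultimately show ?thesis
    using u by auto
qed

text \<open>The sum runs over all of \<open>I\<close>, not \<open>K\<close>, so that weights of the
  full algebra and of a Levi subalgebra are written in the same form.\<close>

definition wtof :: "('i \<Rightarrow> nat) \<Rightarrow> 'h \<Rightarrow> complex" where
  "wtof n = (\<lambda>h. \<Lambda> h - (\<Sum>i\<in>I. of_nat (n i) * \<alpha> i h))"

lemma wtof_zero: "wtof (\<lambda>_. 0) = \<Lambda>"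
  by (simp add: wtof_def)

lemma wtof_add: "wtof (\<lambda>i. n i + n' i) = (\<lambda>h. wtof n h - (\<Sum>i\<in>I. of_nat (n' i) * \<alpha> i h))"
  by (simp add: wtof_def sum.distrib algebra_simps)

lemma wtof_update_add: "i \<in> I \<Longrightarrow> wtof (n(i := n i + k)) = (\<lambda>h. wtof n h - of_nat k * \<alpha> i h)"
  by (auto simp: wtof_def sum.remove[OF gcm(1)] algebra_simps)

lemma wtof_inj:
  assumes "wtof n = wtof n'" "\<And>i. i \<notin> I \<Longrightarrow> n i = n' i"
  shows "n = n'"
proof
  fix i
  show "n i = n' i"
  proof (cases "i \<in> I")
    case True
    have "of_nat (n i) - of_nat (n' i) = (0 :: complex)"
      using assms(1) by (intro simple_roots_independent[OF D _ True, where c = "\<lambda>i. of_nat (n i) - of_nat (n' i)"])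
        (simp add: wtof_def fun_eq_iff left_diff_distrib sum_subtractf)
    then show ?thesis by simp
  qed (rule assms(2))
qed

lemma weight_word:
  assumes "m \<in> wvec \<chi>" "m \<noteq> 0"
  obtains ws where "set ws \<subseteq> K" "foldr F ws v0 \<noteq> 0" "\<chi> = wtof (count_list ws)"
proof -
  have "m \<in> span (words v0)"
    using singular_vector_generates[OF v0_wvec v0(2) E_v0] wvec_V[OF assms(1)] by simp
  moreover have "\<exists>\<psi>. b \<in> wvec \<psi>" if "b \<in> words v0" for b
    using that words_weight[OF v0_wvec] by blast
  ultimately obtain b where b: "b \<in> words v0" "b \<noteq> 0" "b \<in> wvec \<chi>"
    using weight_in_span assms by metis
  then obtain ws where ws: "b = foldr F ws v0" "set ws \<subseteq> K"
    by (auto simp: words_def)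
  then have "\<chi> = wtof (count_list ws)"
    unfolding wtof_def
    by (intro wvec_unique[OF b(3) _ b(2)]) (use wvec_word[OF ws(2) v0_wvec] ws(1) in simp)
  then show thesis
    using that ws b by blast
qed

text \<open>A nonzero \<open>u\<close> would generate \<open>V\<close>, so some word on
  \<open>u\<close> would have weight \<Lambda>. Lowering only adds to the exponents and simple roots
  are independent, so \<open>n\<close> would be 0.\<close>

lemma singular_vector_zero:
  assumes u: "u \<in> wvec (wtof n)" and sing: "\<And>i. i \<in> K \<Longrightarrow> E i u = 0"
    and supp: "\<And>i. i \<notin> I \<Longrightarrow> n i = 0" and n: "n \<noteq> (\<lambda>_. 0)"
  shows "u = 0"
proof (rule ccontr)
  assume "u \<noteq> 0"
  then have "v0 \<in> span (words u)"
    using singular_vector_generates[OF u _ sing] v0 by simp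
  moreover have "\<exists>\<psi>. b \<in> wvec \<psi>" if "b \<in> words u" for b
    using that words_weight[OF u] by blast
  ultimately obtain b where b: "b \<in> words u" "b \<noteq> 0" "b \<in> wvec \<Lambda>"
    using weight_in_span v0_wvec v0 by metis
  then obtain ws where ws: "b = foldr F ws u" "set ws \<subseteq> K"
    by (auto simp: words_def)
  have "wtof (\<lambda>_. 0) = wtof (\<lambda>i. n i + count_list ws i)"
    unfolding wtof_zero wtof_add
    by (rule wvec_unique[OF b(3) _ b(2)]) (use wvec_word[OF ws(2) u] ws(1) in simp)
  then have "(\<lambda>_. 0) = (\<lambda>i. n i + count_list ws i)"
    by (rule wtof_inj) (use supp ws K in \<open>auto simp: count_list_0_iff\<close>)
  then show False
    using n by (auto simp: fun_eq_iff)
qed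

end

section \<open>Local nilpotency, injectivity and reflections\<close>

context km_rep begin

text \<open>This vector is singular: \<open>E i\<close> produces the coefficient
  \<open>(k+1)(k-k)\<close>, and every other \<open>E j\<close> commutes with \<open>F i\<close> and
  reaches \<open>v0\<close>. Its weight lies strictly below \<Lambda>.\<close>

lemma F_funpow_zero:
  assumes i: "i \<in> K" and k: "\<Lambda> (\<alpha>c i) = of_nat k"
  shows "(F i ^^ Suc k) v0 = 0"
proof (rule singular_vector_zero)
  have "(\<lambda>h. \<Lambda> h - of_nat (Suc k) * \<alpha> i h) = wtof ((\<lambda>_. 0)(i := 0 + Suc k))"
    using wtof_update_add[of i "\<lambda>_. 0" "Suc k"] K_in_I[OF i] by (simp add: wtof_zero)
  then show "(F i ^^ Suc k) v0 \<in> wvec (wtof ((\<lambda>_. 0)(i := 0 + Suc k)))"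
    using wvec_F_funpow[OF i v0_wvec, of "Suc k"] by simp
  show "E j ((F i ^^ Suc k) v0) = 0" if j: "j \<in> K" for j
  proof (cases "j = i")
    case True
    have "E i ((F i ^^ Suc k) v0) =
        (F i ^^ Suc k) (E i v0) + (of_nat (Suc k) * (of_nat k - of_nat k)) *s (F i ^^ k) v0"
      using EF_same[OF i] HF[OF i] root_coroot_same[OF i] H_v0[of "\<alpha>c i"] k
      by (intro sl2_commute_funpow[OF E[OF i] F[OF i] H]) (auto simp: v0)
    then show ?thesis
      using E_v0[OF i] endo_zero[OF endo_funpow[OF F[OF i], of "Suc k"]] True by (simp del: funpow.simps)
  next
    case False
    have "E j ((F i ^^ n) v0) = 0" for n
    proof (induction n)
      case (Suc n)
      have "(F i ^^ n) v0 \<in> V"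
        by (rule endoD(1)[OF endo_funpow[OF F[OF i]] v0(1)])
      then show ?case
        using EF_diff[OF j i False] Suc endo_zero[OF F[OF i]] by simp
    qed (simp add: E_v0 j)
    then show ?thesis .
  qed
qed (use K i in \<open>auto simp: fun_eq_iff\<close>)

text \<open>\<open>E i\<close> returns each power to a multiple of the previous one, with a factor
  that is zero only if the value of \<Lambda> at the coroot is a natural number.\<close>

lemma F_funpow_nonzero:
  assumes i: "i \<in> K" and nonint: "\<Lambda> (\<alpha>c i) \<notin> \<nat>"
  shows "(F i ^^ k) v0 \<noteq> 0"
proof (induction k)
  case (Suc k)
  have "E i ((F i ^^ Suc k) v0) =
      (F i ^^ Suc k) (E i v0) + (of_nat (Suc k) * (\<Lambda> (\<alpha>c i) - of_nat k)) *s (F i ^^ k) v0"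
    using EF_same[OF i] HF[OF i] root_coroot_same[OF i] H_v0[of "\<alpha>c i"]
    by (intro sl2_commute_funpow[OF E[OF i] F[OF i] H]) (auto simp: v0)
  moreover have "of_nat (Suc k) * (\<Lambda> (\<alpha>c i) - of_nat k) \<noteq> 0"
    using nonint by (auto simp del: of_nat_Suc)
  ultimately have "E i ((F i ^^ Suc k) v0) \<noteq> 0"
    using Suc E_v0[OF i] endo_zero[OF endo_funpow[OF F[OF i], of "Suc k"]]
    by (simp del: funpow.simps of_nat_Suc)
  then show ?case
    using endo_zero[OF E[OF i]] by auto
qed (simp add: v0)

section \<open>Local nilpotency or injectivity of a lowering operator\<close>

definition F_torsion :: "'i \<Rightarrow> 'v set" where
  "F_torsion i = {w\<in>V. \<exists>n. (F i ^^ n) w = 0}"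

lemma F_torsion_closed:
  assumes i: "i \<in> K" and X: "endo X" and ad: "\<forall>v\<in>V. (op_bracket (F i) ^^ k) X v = 0"
    and w: "w \<in> F_torsion i"
  shows "X w \<in> F_torsion i"
proof -
  obtain n where "w \<in> V" "(F i ^^ n) w = 0"
    using w by (auto simp: F_torsion_def)
  then show ?thesis
    using nilpotent_commute[OF F[OF i] X ad] endoD(1)[OF X] by (auto simp: F_torsion_def)
qed

text \<open>\<open>ad (F i)\<close> is nilpotent on every generator, so the torsion is a submodule.
  The orders used are 2 on \<open>H h\<close>, 1 on \<open>F i\<close>, the Serre exponent on other
  \<open>F j\<close>, 3 on \<open>E i\<close> and 1 on other \<open>E j\<close>.\<close>

lemma F_torsion_dichotomy:
  assumes i: "i \<in> K"
  shows "F_torsion i = {0} \<or> F_torsion i = V"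
proof (rule irreducible)
  note Fi = F[OF i] and Fn = endo_funpow[OF F[OF i]]
  have later: "(F i ^^ (n + k)) w = 0" if "(F i ^^ n) w = 0" for n k w
  proof -
    have "(F i ^^ (k + n)) w = 0"
      using that endo_zero[OF Fn] by (simp add: funpow_add)
    then show ?thesis by (simp add: add.commute)
  qed
  show "subspace (F_torsion i)"
  proof (rule subspaceI)
    show "0 \<in> F_torsion i"
      using V_closed by (auto simp: F_torsion_def intro: exI[of _ 0])
    show "c *s x \<in> F_torsion i" if "x \<in> F_torsion i" for c x
      using that endoD(3)[OF Fn] by (auto simp: F_torsion_def V_closed)
    show "x + y \<in> F_torsion i" if xy: "x \<in> F_torsion i" "y \<in> F_torsion i" for x y
    proof -
      obtain m n where "x \<in> V" "(F i ^^ m) x = 0" "y \<in> V" "(F i ^^ n) y = 0"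
        using xy by (auto simp: F_torsion_def)
      then have "(F i ^^ (m + n)) (x + y) = 0"
        using later[of m x n] later[of n y m] by (simp add: endoD(2)[OF Fn] add.commute)
      then show ?thesis
        using \<open>x \<in> V\<close> \<open>y \<in> V\<close> by (auto simp: F_torsion_def V_closed)
    qed
  qed
  have FV: "v \<in> V \<Longrightarrow> F i v \<in> V" and HV: "v \<in> V \<Longrightarrow> H h v \<in> V" for v h
    by (rule endoD(1)[OF Fi], assumption) (rule endoD(1)[OF H])
  show "H h u \<in> F_torsion i" if "u \<in> F_torsion i" for h u
  proof (rule F_torsion_closed[OF i H _ that])
    have 1: "op_bracket (F i) (H h) v = \<alpha> i h *s F i v" if "v \<in> V" for v
      using HF[OF i that] by (simp add: op_bracket_def)
    have "op_bracket (F i) (op_bracket (F i) (H h)) v = 0" if "v \<in> V" for v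
      unfolding op_bracket_def[of "F i" "op_bracket (F i) (H h)"]
      using that by (simp add: 1 FV endoD(3)[OF Fi])
    then show "\<forall>v\<in>V. (op_bracket (F i) ^^ 2) (H h) v = 0"
      by (simp add: numeral_2_eq_2)
  qed
  show "F j u \<in> F_torsion i" if j: "j \<in> K" and u: "u \<in> F_torsion i" for j u
  proof (cases "j = i")
    case True
    have "\<forall>v\<in>V. (op_bracket (F i) ^^ 1) (F j) v = 0"
      by (simp add: op_bracket_def True)
    then show ?thesis
      by (rule F_torsion_closed[OF i F[OF j] _ u])
  next
    case False
    then have "\<forall>v\<in>V. (op_bracket (F i) ^^ nat (1 - A i j)) (F j) v = 0"
      using serre i j by blast
    then show ?thesis
      by (rule F_torsion_closed[OF i F[OF j] _ u])
  qed
  show "E j u \<in> F_torsion i" if j: "j \<in> K" and u: "u \<in> F_torsion i" for j u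
  proof (cases "j = i")
    case True
    let ?ad = "op_bracket (F i)"
    have 1: "?ad (E i) v = - H (\<alpha>c i) v" if "v \<in> V" for v
      using EF_same[OF i that] by (simp add: op_bracket_def)
    have 2: "?ad (?ad (E i)) v = - (2 *s F i v)" if "v \<in> V" for v
      unfolding op_bracket_def[of "F i" "?ad (E i)"]
      using that by (simp add: 1 FV HV endo_uminus[OF Fi] HF[OF i] root_coroot_same[OF i])
    have "?ad (?ad (?ad (E i))) v = 0" if "v \<in> V" for v
      unfolding op_bracket_def[of "F i" "?ad (?ad (E i))"]
      using that by (simp add: 2 FV V_closed endo_uminus[OF Fi] endoD(3)[OF Fi])
    then have "\<forall>v\<in>V. (?ad ^^ 3) (E j) v = 0"
      by (simp add: numeral_3_eq_3 True)
    then show ?thesis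
      by (rule F_torsion_closed[OF i E[OF j] _ u])
  next
    case False
    then have "\<forall>v\<in>V. (op_bracket (F i) ^^ 1) (E j) v = 0"
      using EF_diff[OF j i] by (simp add: op_bracket_def)
    then show ?thesis
      by (rule F_torsion_closed[OF i E[OF j] _ u])
  qed
qed (auto simp: F_torsion_def)

lemma F_locally_nilpotent:
  assumes "i \<in> K" "\<Lambda> (\<alpha>c i) \<in> \<nat>" "w \<in> V"
  obtains n where "(F i ^^ n) w = 0"
proof -
  have "v0 \<in> F_torsion i"
    using F_funpow_zero assms(1,2) v0(1) by (auto simp: F_torsion_def Nats_def simp del: funpow.simps)
  then have "w \<in> F_torsion i"
    using F_torsion_dichotomy[OF assms(1)] v0(2) assms(3) by auto
  then show thesis
    using that by (auto simp: F_torsion_def)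
qed

text \<open>One nonzero kernel vector would make the torsion all of \<open>V\<close>, including
  \<open>v0\<close>, whose \<open>F i\<close>-powers never vanish.\<close>

lemma F_injective:
  assumes "i \<in> K" "\<Lambda> (\<alpha>c i) \<notin> \<nat>" "w \<in> V" "w \<noteq> 0"
  shows "F i w \<noteq> 0"
proof
  assume "F i w = 0"
  then have "(F i ^^ 1) w = 0" by simp
  then have "w \<in> F_torsion i"
    using assms(3) unfolding F_torsion_def by blast
  then have "v0 \<in> F_torsion i"
    using F_torsion_dichotomy[OF assms(1)] assms(4) v0(1) by auto
  then show False
    using F_funpow_nonzero[OF assms(1,2)] by (auto simp: F_torsion_def)
qed

section \<open>Weights as exponent vectors and their reflections\<close>

definition wts :: "('i \<Rightarrow> nat) set" where
  "wts = {n. (\<forall>i. i \<notin> K \<longrightarrow> n i = 0) \<and> wvec (wtof n) \<noteq> {0}}"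

lemma wts_iff:
  "n \<in> wts \<longleftrightarrow> (\<forall>i. i \<notin> K \<longrightarrow> n i = 0) \<and> (\<exists>m. m \<in> wvec (wtof n) \<and> m \<noteq> 0)"
  using wvec_zero by (auto simp: wts_def)

lemma wts_support: "n \<in> wts \<Longrightarrow> i \<notin> K \<Longrightarrow> n i = 0"
  by (simp add: wts_def)

lemma count_list_support: "set ws \<subseteq> K \<Longrightarrow> i \<notin> K \<Longrightarrow> count_list ws i = 0"
  by (meson count_notin subsetD)

lemma wtof_eqI:
  assumes "wtof n = wtof n'" "\<And>i. i \<notin> K \<Longrightarrow> n i = 0" "\<And>i. i \<notin> K \<Longrightarrow> n' i = 0"
  shows "n = n'"
  by (rule wtof_inj[OF assms(1)]) (metis assms(2,3) K_in_I)

lemma weight_in_wts: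
  assumes "wvec \<chi> \<noteq> {0}"
  obtains ws where "set ws \<subseteq> K" "foldr F ws v0 \<noteq> 0" "\<chi> = wtof (count_list ws)" "count_list ws \<in> wts"
proof -
  obtain m where "m \<in> wvec \<chi>" "m \<noteq> 0"
    using assms wvec_zero by blast
  then obtain ws where "set ws \<subseteq> K" "foldr F ws v0 \<noteq> 0" "\<chi> = wtof (count_list ws)"
    by (rule weight_word)
  then show thesis
    using that assms count_list_support unfolding wts_def by auto
qed

text \<open>Every weight is \<Lambda> minus a nonnegative combination of roots; raising
  \<open>n i + 1\<close> times would require a negative exponent at \<open>i\<close>.\<close>

lemma E_locally_nilpotent:
  assumes n: "n \<in> wts" and i: "i \<in> K" and m: "m \<in> wvec (wtof n)"
  shows "(E i ^^ Suc (n i)) m = 0"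
proof (rule ccontr)
  let ?\<chi> = "\<lambda>h. wtof n h + of_nat (Suc (n i)) * \<alpha> i h"
  assume "(E i ^^ Suc (n i)) m \<noteq> 0"
  then have "wvec ?\<chi> \<noteq> {0}"
    using wvec_E_funpow[OF i m, of "Suc (n i)"] by blast
  then obtain ws where ws: "set ws \<subseteq> K" "?\<chi> = wtof (count_list ws)"
    by (rule weight_in_wts)
  let ?k = "count_list ws"
  have "wtof (?k(i := ?k i + Suc (n i))) = wtof n"
    unfolding wtof_update_add[OF K_in_I[OF i]] ws(2)[symmetric] by simp
  then have "?k(i := ?k i + Suc (n i)) = n"
    by (rule wtof_eqI) (use wts_support[OF n] count_list_support[OF ws(1)] i in auto)
  then have "?k i + Suc (n i) = n i"
    by (metis fun_upd_same)
  then show False by simp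
qed

text \<open>\<open>sl2_reflection\<close> makes \<open>F i ^^ k\<close> nonzero on a weight vector,
  using that \<open>E i\<close> is nilpotent on it. For positive \<open>k\<close> this power factors
  through \<open>F i\<close>, so the first step of the string survives too.\<close>

lemma wts_raise:
  assumes n: "n \<in> wts" and i: "i \<in> K" and k: "wtof n (\<alpha>c i) = of_nat k"
  shows "n(i := n i + k) \<in> wts" and "0 < k \<Longrightarrow> n(i := Suc (n i)) \<in> wts"
proof -
  obtain m where m: "m \<in> wvec (wtof n)" "m \<noteq> 0"
    using n by (auto simp: wts_iff)
  note Fi = F[OF i]
  have Fk: "(F i ^^ k) m \<noteq> 0"
  proof
    assume *: "(F i ^^ k) m = 0"
    have "m = 0"
    proof (rule sl2_reflection[OF E[OF i] Fi H _ _ _ wvec_V[OF m(1)] _ E_locally_nilpotent[OF n i m(1)] *])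
      show "H (\<alpha>c i) m = of_nat k *s m"
        using m(1) k by (simp add: wvec_def)
    qed (use EF_same[OF i] HE[OF i] HF[OF i] root_coroot_same[OF i] in auto)
    with m(2) show False ..
  qed
  show "n(i := n i + k) \<in> wts"
    using Fk wvec_F_funpow[OF i m(1), of k] n i
    unfolding wts_iff wtof_update_add[OF K_in_I[OF i]] by auto
  show "n(i := Suc (n i)) \<in> wts" if "0 < k"
  proof -
    have "F i m \<noteq> 0"
    proof
      assume "F i m = 0"
      then have "(F i ^^ k) m = 0"
        using that endo_zero[OF endo_funpow[OF Fi]] by (cases k) (auto simp: funpow_swap1)
      then show False using Fk by simp
    qed
    moreover have "F i m \<in> wvec (wtof (n(i := n i + 1)))"
      using wvec_F[OF i m(1)] unfolding wtof_update_add[OF K_in_I[OF i]] by simp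
    ultimately show ?thesis
      using n i by (auto simp: wts_iff)
  qed
qed

text \<open>The mirror image: \<open>sl2_reflection\<close> with \<open>E\<close> and
  \<open>F\<close> exchanged and \<open>H\<close> negated. Its nilpotency hypothesis is now local
  nilpotency of \<open>F i\<close>, which is where integrality enters.\<close>

lemma wts_lower:
  assumes n: "n \<in> wts" and i: "i \<in> K" and int: "\<Lambda> (\<alpha>c i) \<in> \<nat>"
    and k: "wtof n (\<alpha>c i) = - of_nat k"
  shows "k \<le> n i" and "n(i := n i - k) \<in> wts"
proof -
  obtain m where m: "m \<in> wvec (wtof n)" "m \<noteq> 0"
    using n by (auto simp: wts_iff)
  have mV: "m \<in> V" using m wvec_V by blast
  obtain l where l: "(F i ^^ l) m = 0"
    using F_locally_nilpotent[OF i int mV] .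
  have Hneg: "endo (\<lambda>v. - H (\<alpha>c i) v)"
    using endoD[OF H] V_closed by (auto simp: endo_def)
  have Ek: "(E i ^^ k) m \<noteq> 0"
  proof
    assume *: "(E i ^^ k) m = 0"
    have "m = 0"
    proof (rule sl2_reflection[OF F[OF i] E[OF i] Hneg _ _ _ mV _ l *])
      show "- H (\<alpha>c i) m = of_nat k *s m"
        using m(1) k by (simp add: wvec_def)
      show "\<forall>v\<in>V. - H (\<alpha>c i) (F i v) = F i (- H (\<alpha>c i) v) + 2 *s F i v"
        using HF[OF i] root_coroot_same[OF i] endo_uminus[OF F[OF i]] endoD(1)[OF H] by simp
      show "\<forall>v\<in>V. - H (\<alpha>c i) (E i v) = E i (- H (\<alpha>c i) v) - 2 *s E i v"
        using HE[OF i] root_coroot_same[OF i] endo_uminus[OF E[OF i]] endoD(1)[OF H] by simp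
    qed (use EF_same[OF i] in auto)
    with m(2) show False ..
  qed
  let ?\<chi> = "\<lambda>h. wtof n h + of_nat k * \<alpha> i h"
  have "wvec ?\<chi> \<noteq> {0}"
    using wvec_E_funpow[OF i m(1), of k] Ek by blast
  \<comment> \<open>Expressing the reflected weight by a word makes its exponents natural numbers;
    comparison with \<open>n\<close> then yields \<open>k \<le> n i\<close>.\<close>
  then obtain ws where ws: "set ws \<subseteq> K" "?\<chi> = wtof (count_list ws)" "count_list ws \<in> wts"
    by (rule weight_in_wts)
  let ?c = "count_list ws"
  have "wtof (?c(i := ?c i + k)) = wtof n"
    unfolding wtof_update_add[OF K_in_I[OF i]] ws(2)[symmetric] by simp
  then have eq: "?c(i := ?c i + k) = n"
    by (rule wtof_eqI) (use wts_support[OF n] count_list_support[OF ws(1)] i in auto)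
  then have ni: "n i = ?c i + k"
    by (metis fun_upd_same)
  then show "k \<le> n i" by simp
  have "n(i := n i - k) = ?c"
    using eq ni by auto
  then show "n(i := n i - k) \<in> wts"
    using ws by simp
qed

text \<open>Build \<open>n\<close> up from 0 one unit at a time; each unit is an application of an
  injective \<open>F i\<close>.\<close>

lemma wts_nonintegral:
  assumes "\<And>i. i \<notin> K \<Longrightarrow> n i = 0" "\<And>i. i \<in> K \<Longrightarrow> n i \<noteq> 0 \<Longrightarrow> \<Lambda> (\<alpha>c i) \<notin> \<nat>"
  shows "n \<in> wts"
  using assms
proof (induction "\<Sum>i\<in>I. n i" arbitrary: n rule: less_induct)
  case less
  show ?case
  proof (cases "\<forall>i. n i = 0")
    case True
    then have "n = (\<lambda>_. 0)" by auto
    then show ?thesis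
      using v0_wvec v0 by (auto simp: wts_iff wtof_zero)
  next
    case False
    then obtain i where i: "n i \<noteq> 0" "i \<in> K"
      using less.prems(1) by blast
    define n' where "n' = n(i := n i - 1)"
    have "n' \<in> wts"
    proof (rule less.hyps)
      show "(\<Sum>i\<in>I. n' i) < (\<Sum>i\<in>I. n i)"
        using gcm(1) K_in_I[OF i(2)] i(1) by (intro sum_strict_mono_ex1) (auto simp: n'_def)
    qed (use less.prems in \<open>auto simp: n'_def split: if_splits\<close>)
    then obtain m where m: "m \<in> wvec (wtof n')" "m \<noteq> 0"
      by (auto simp: wts_iff)
    have "F i m \<in> wvec (wtof (n'(i := n' i + 1)))"
      using wvec_F[OF i(2) m(1)] unfolding wtof_update_add[OF K_in_I[OF i(2)]] by simp
    moreover have "n'(i := n' i + 1) = n"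
      using i by (auto simp: n'_def)
    ultimately show ?thesis
      using F_injective[OF i(2) less.prems(2)[OF i(2,1)] wvec_V[OF m(1)] m(2)] less.prems(1)
      by (auto simp: wts_iff)
  qed
qed

lemma F_commute_word:
  assumes i: "i \<in> K" and ws: "set ws \<subseteq> K" "\<And>j. j \<in> set ws \<Longrightarrow> j \<noteq> i \<and> A i j = 0" and v: "v \<in> V"
  shows "F i (foldr F ws v) = foldr F ws (F i v)"
  using ws
proof (induction ws)
  case (Cons j ws)
  have "foldr F ws v \<in> V"
    using words_V[OF v] Cons.prems by (auto simp: words_def)
  \<comment> \<open>For \<open>A i j = 0\<close> the Serre exponent is 1, so the relation says that
    \<open>F i\<close> and \<open>F j\<close> commute.\<close>
  then have "F i (F j (foldr F ws v)) = F j (F i (foldr F ws v))"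
    using serre[OF i, of j "foldr F ws v"] Cons.prems(1) Cons.prems(2)[of j]
    by (auto simp: op_bracket_def)
  then show ?case
    using Cons by simp
qed simp

text \<open>In a nonzero word with letter counts \<open>n\<close>, the letters acting before the
  rightmost letter from \<open>Z\<close> are orthogonal to it. It therefore commutes down to
  \<open>v0\<close>, where \<Lambda> vanishes on its coroot and it acts as zero.\<close>

lemma wts_nondegenerate:
  assumes n: "n \<in> wts" and Z: "Z \<subseteq> K" "Z \<noteq> {}" "\<And>i. i \<in> Z \<Longrightarrow> 0 < n i \<and> \<Lambda> (\<alpha>c i) = 0"
    and orth: "\<And>i j. i \<in> Z \<Longrightarrow> j \<in> I - Z \<Longrightarrow> 0 < n j \<Longrightarrow> A i j = 0"
  shows False
proof -
  obtain ws where ws: "set ws \<subseteq> K" "foldr F ws v0 \<noteq> 0" "wtof n = wtof (count_list ws)"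
  proof -
    have "wvec (wtof n) \<noteq> {0}"
      using n by (simp add: wts_def)
    then show thesis
      using weight_in_wts that by blast
  qed
  have nws: "n = count_list ws"
    by (rule wtof_eqI[OF ws(3)]) (use wts_support[OF n] count_list_support[OF ws(1)] in auto)
  obtain i0 where "i0 \<in> Z" using Z by blast
  then have "\<exists>x\<in>set ws. x \<in> Z"
    using Z(3) nws by (metis count_notin less_numeral_extra(3))
  \<comment> \<open>The last occurrence is taken because \<open>foldr\<close> applies the right end
    of the word first; \<open>suf\<close> then has no letter in \<open>Z\<close>.\<close>
  then obtain pre i suf where split: "ws = pre @ i # suf" "i \<in> Z" "\<forall>z\<in>set suf. z \<notin> Z"
    using split_list_last_prop[where P = "\<lambda>x. x \<in> Z"] by blast
  have i: "i \<in> K" using split Z by blast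
  have "F i (foldr F suf v0) = foldr F suf (F i v0)"
  proof (rule F_commute_word[OF i _ _ v0(1)])
    show "j \<noteq> i \<and> A i j = 0" if "j \<in> set suf" for j
    proof -
      have "0 < n j"
        using that by (auto simp: nws split(1) count_list_0_iff intro!: gr0I)
      then show ?thesis
        using that split orth[of i j] ws(1) K by auto
    qed
  qed (use ws split in auto)
  moreover have "F i v0 = 0"
    using F_funpow_zero[OF i, of 0] Z(3) split by simp
  moreover have zero: "foldr F us 0 = 0" if "set us \<subseteq> K" for us
    using that by (induction us) (auto simp: endo_zero[OF F])
  moreover have "foldr F suf 0 = 0"
    using zero ws split by simp
  ultimately have "foldr F ws v0 = foldr F pre 0"
    using split by simp
  then show False
    using zero ws split by simp
qed

lemma wvec_nonzero_iff: "wvec \<chi> \<noteq> {0} \<longleftrightarrow> \<chi> \<in> wtof ` wts"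
proof
  assume "wvec \<chi> \<noteq> {0}"
  then show "\<chi> \<in> wtof ` wts"
    using weight_in_wts by blast
qed (auto simp: wts_def)

text \<open>With \<open>n0\<close> supported off \<open>J\<close>, it collects the
  \<open>J\<close>-parts of the weights whose part off \<open>J\<close> is
  \<open>n0\<close>.\<close>

definition slice :: "'i set \<Rightarrow> ('i \<Rightarrow> nat) \<Rightarrow> ('i \<Rightarrow> nat) set" where
  "slice J n0 = {\<beta>. (\<forall>i. i \<notin> J \<longrightarrow> \<beta> i = 0) \<and> (\<lambda>i. n0 i + \<beta> i) \<in> wts}"

lemma wtof_coroot:
  assumes "i \<in> I"
  shows "wtof n (\<alpha>c i) = \<Lambda> (\<alpha>c i) - of_int (\<Sum>j\<in>I. A i j * int (n j))"
  using gcm(4)[OF assms] by (simp add: wtof_def mult.commute)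

text \<open>The numbers \<open>L i\<close> are the values of the slice's top weight
  \<open>wtof n0\<close> at the coroots, so pairings match coroot values of weights. Raising,
  lowering and nondegeneracy of \<open>wts\<close> then give the clauses.\<close>

lemma weight_slice_slice:
  assumes J: "J \<subseteq> K" and int: "\<And>i. i \<in> J \<Longrightarrow> \<Lambda> (\<alpha>c i) \<in> \<nat>"
    and n0: "\<And>i. i \<notin> K - J \<Longrightarrow> n0 i = 0"
    and L: "\<And>i. i \<in> J \<Longrightarrow> of_int (L i) = wtof n0 (\<alpha>c i)"
  shows "weight_slice J A L (slice J n0)"
proof -
  have JI: "J \<subseteq> I" using J K by blast
  have L_eq: "of_int (L i) = \<Lambda> (\<alpha>c i) - of_int (\<Sum>j\<in>I. A i j * int (n0 j))" if "i \<in> J" for i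
    using L[OF that] wtof_coroot[of i n0] that JI by (simp add: subset_iff)
  have pair: "wtof (\<lambda>j. n0 j + \<beta> j) (\<alpha>c i) = of_int (pairing J A L \<beta> i)"
    if \<beta>: "\<beta> \<in> slice J n0" and i: "i \<in> J" for \<beta> i
  proof -
    have "(\<Sum>j\<in>I. A i j * int (\<beta> j)) = (\<Sum>j\<in>J. A i j * int (\<beta> j))"
      using \<beta> JI gcm(1) by (intro sum.mono_neutral_right) (auto simp: slice_def)
    then show ?thesis
      using wtof_coroot[of i "\<lambda>j. n0 j + \<beta> j"] i JI
      by (auto simp: pairing_def L_eq distrib_left sum.distrib)
  qed
  have upd: "(\<lambda>j. n0 j + (\<beta>(i := b)) j) = (\<lambda>j. n0 j + \<beta> j)(i := b)" if "i \<in> J" for i \<beta> b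
    using n0[of i] that by auto
  have raise: "\<beta>(i := \<beta> i + nat (pairing J A L \<beta> i)) \<in> slice J n0 \<and> \<beta>(i := Suc (\<beta> i)) \<in> slice J n0"
    if \<beta>: "\<beta> \<in> slice J n0" and i: "i \<in> J" and pos: "0 < pairing J A L \<beta> i" for \<beta> i
  proof -
    let ?n = "\<lambda>j. n0 j + \<beta> j"
    have "?n \<in> wts" "i \<in> K" "wtof ?n (\<alpha>c i) = of_nat (nat (pairing J A L \<beta> i))"
      using pair[OF \<beta> i] \<beta> i J pos by (auto simp: slice_def)
    from wts_raise[OF this] show ?thesis
      using \<beta> i pos n0[of i] unfolding slice_def mem_Collect_eq upd[OF i] by auto
  qed
  have lower: "nat (- pairing J A L \<beta> i) \<le> \<beta> i \<and> \<beta>(i := \<beta> i - nat (- pairing J A L \<beta> i)) \<in> slice J n0"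
    if \<beta>: "\<beta> \<in> slice J n0" and i: "i \<in> J" and neg: "pairing J A L \<beta> i < 0" for \<beta> i
  proof -
    let ?n = "\<lambda>j. n0 j + \<beta> j"
    have "?n \<in> wts" "i \<in> K" "\<Lambda> (\<alpha>c i) \<in> \<nat>" "wtof ?n (\<alpha>c i) = - of_nat (nat (- pairing J A L \<beta> i))"
      using pair[OF \<beta> i] \<beta> i J neg int by (auto simp: slice_def)
    from wts_lower[OF this] show ?thesis
      using \<beta> i n0[of i] unfolding slice_def mem_Collect_eq upd[OF i] by auto
  qed
  have nondeg: "\<exists>i\<in>Z. \<exists>j\<in>J - Z. A i j * int (\<beta> j) \<noteq> 0"
    if \<beta>: "\<beta> \<in> slice J n0" and Z: "Z \<subseteq> J" "Z \<noteq> {}" "\<forall>i\<in>Z. 0 < \<beta> i \<and> L i = 0" for \<beta> Z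
  proof (rule ccontr)
    assume "\<not> ?thesis"
    then have orth: "A i j * int (\<beta> j) = 0" if "i \<in> Z" "j \<in> J - Z" for i j
      using that by blast
    let ?n = "\<lambda>j. n0 j + \<beta> j"
    \<comment> \<open>\<open>L i = 0\<close> is the sum of a natural number and the negative of a
      sum of nonpositive terms, so all of these vanish. This extends orthogonality from
      \<open>J\<close> to the support of \<open>n0\<close>.\<close>
    have key: "\<Lambda> (\<alpha>c i) = 0 \<and> (\<forall>j\<in>I. A i j * int (n0 j) = 0)" if "i \<in> Z" for i
    proof -
      have i: "i \<in> J" "i \<in> I" "L i = 0" using that Z JI by auto
      obtain k where k: "\<Lambda> (\<alpha>c i) = of_nat k"
        using int[OF i(1)] by (auto simp: Nats_def)
      have "(of_int (int k) :: complex) = of_int (\<Sum>j\<in>I. A i j * int (n0 j))"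
        using L_eq[OF i(1)] i(3) k by simp
      then have eq: "int k = (\<Sum>j\<in>I. A i j * int (n0 j))"
        using of_int_eq_iff by blast
      have nonpos: "A i j * int (n0 j) \<le> 0" if "j \<in> I" for j
      proof (cases "j \<in> K - J")
        case True
        then have "A i j \<le> 0" using gcm(3)[OF i(2) that] i(1) by blast
        then show ?thesis by (simp add: mult_nonpos_nonneg)
      qed (simp add: n0)
      then have "(\<Sum>j\<in>I. A i j * int (n0 j)) \<le> 0"
        by (intro sum_nonpos) auto
      then have k0: "k = 0" "(\<Sum>j\<in>I. - (A i j * int (n0 j))) = 0"
        using eq by (auto simp: sum_negf)
      then have "\<forall>j\<in>I. - (A i j * int (n0 j)) = 0"
        using nonpos gcm(1) sum_nonneg_eq_0_iff[of I "\<lambda>j. - (A i j * int (n0 j))"] by simp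
      then show ?thesis
        using k k0 by simp
    qed
    show False
    proof (rule wts_nondegenerate[of ?n Z])
      show "?n \<in> wts" using \<beta> by (simp add: slice_def)
      show "A i j = 0" if "i \<in> Z" "j \<in> I - Z" "0 < ?n j" for i j
      proof (cases "j \<in> J")
        case True
        then show ?thesis using orth[of i j] n0[of j] that by auto
      next
        case False
        then show ?thesis using key[OF that(1)] \<beta> that by (auto simp: slice_def)
      qed
    qed (use Z J key in auto)
  qed
  show ?thesis
    unfolding weight_slice_def
    using raise lower nondeg by (intro conjI ballI allI impI) (auto simp: slice_def)
qed

end

section \<open>From modules over the presented algebra to operators\<close>

lemma lie_terms_simps [simp]:
  "LGen x \<in> lie_terms X \<longleftrightarrow> x \<in> X"
  "LZero \<in> lie_terms X"
  "LAdd s t \<in> lie_terms X \<longleftrightarrow> s \<in> lie_terms X \<and> t \<in> lie_terms X"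
  "LScale c s \<in> lie_terms X \<longleftrightarrow> s \<in> lie_terms X"
  "LBr s t \<in> lie_terms X \<longleftrightarrow> s \<in> lie_terms X \<and> t \<in> lie_terms X"
  by (auto simp: lie_terms_def)

lemma lie_terms_mono: "X \<subseteq> Y \<Longrightarrow> t \<in> lie_terms X \<Longrightarrow> t \<in> lie_terms Y"
  by (auto simp: lie_terms_def)

lemma lie_cong_terms: "(s, t) \<in> lie_cong X R \<Longrightarrow> s \<in> lie_terms X \<and> t \<in> lie_terms X"
  by (induction rule: lie_cong.induct) auto

lemma equiv_lie_cong: "equiv (lie_terms X) (lie_cong X R)"
proof (rule equivI)
  show "lie_cong X R \<subseteq> lie_terms X \<times> lie_terms X"
    using lie_cong_terms by fast
  show "refl_on (lie_terms X) (lie_cong X R)"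
    by (auto simp: refl_on_def intro: lie_cong.refl)
  show "Relation.sym (lie_cong X R)"
    by (auto intro: symI lie_cong.sym)
  show "Relation.trans (lie_cong X R)"
    by (auto intro: transI lie_cong.trans)
qed

lemma presented_class_simps:
  fixes X R
  defines "P \<equiv> presented_lie_algebra X R" and "cls \<equiv> \<lambda>s. lie_cong X R `` {s}"
  assumes s: "s \<in> lie_terms X" and t: "t \<in> lie_terms X"
  shows "lie_add P (cls s) (cls t) = cls (LAdd s t)"
    and "lie_scale P c (cls s) = cls (LScale c s)"
    and "lie_bracket P (cls s) (cls t) = cls (LBr s t)"
proof -
  note e = equiv_lie_cong[of X R]
  have "congruent2 (lie_cong X R) (lie_cong X R) (\<lambda>s t. cls (LAdd s t))"
    unfolding cls_def by (intro congruent2I' equiv_class_eq[OF e] lie_cong.cong_add)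
  then show "lie_add P (cls s) (cls t) = cls (LAdd s t)"
    using UN_equiv_class2[OF e e _ s t] by (simp add: P_def presented_lie_algebra_def cls_def)
  have "congruent2 (lie_cong X R) (lie_cong X R) (\<lambda>s t. cls (LBr s t))"
    unfolding cls_def by (intro congruent2I' equiv_class_eq[OF e] lie_cong.cong_br)
  then show "lie_bracket P (cls s) (cls t) = cls (LBr s t)"
    using UN_equiv_class2[OF e e _ s t] by (simp add: P_def presented_lie_algebra_def cls_def)
  have "congruent (lie_cong X R) (\<lambda>s. cls (LScale c s))"
    unfolding cls_def by (intro congruentI equiv_class_eq[OF e] lie_cong.cong_scale)
  then show "lie_scale P c (cls s) = cls (LScale c s)"
    using UN_equiv_class[OF e _ s] by (simp add: P_def presented_lie_algebra_def cls_def)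
qed

definition km_class :: "('h::ab_group_add, 'i) km_datum \<Rightarrow> ('h, 'i) km_gen lie_term \<Rightarrow> ('h, 'i) km_elem" where
  "km_class D t = lie_cong (km_gens D) (km_rels D) `` {t}"

lemma km_gen_class_eq: "km_gen_class D x = km_class D (LGen x)"
  by (simp add: km_gen_class_def km_class_def)

lemma km_class_cong: "(s, t) \<in> lie_cong (km_gens D) (km_rels D) \<Longrightarrow> km_class D s = km_class D t"
  unfolding km_class_def by (rule equiv_class_eq[OF equiv_lie_cong])

lemma km_class_simps:
  assumes "s \<in> lie_terms (km_gens D)" "t \<in> lie_terms (km_gens D)"
  shows "lie_add (km_algebra D) (km_class D s) (km_class D t) = km_class D (LAdd s t)"
    and "lie_scale (km_algebra D) c (km_class D s) = km_class D (LScale c s)"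
    and "lie_bracket (km_algebra D) (km_class D s) (km_class D t) = km_class D (LBr s t)"
  unfolding km_algebra_def km_class_def by (rule presented_class_simps[OF assms])+

lemma km_zero: "lie_zero (km_algebra D) = km_class D LZero"
  by (simp add: km_algebra_def presented_lie_algebra_def km_class_def)

definition levi_gens :: "'i set \<Rightarrow> ('h, 'i) km_gen set" where
  "levi_gens J = range GH \<union> GE ` J \<union> GF ` J"

lemma km_gens_eq: "km_gens D = levi_gens (index_set D)"
  by (simp add: km_gens_def levi_gens_def)

lemma levi_gens_mono: "J \<subseteq> J' \<Longrightarrow> levi_gens J \<subseteq> levi_gens J'"
  by (auto simp: levi_gens_def)

lemma levi_eq: "levi D J = lie_generated (km_algebra D) (km_gen_class D ` levi_gens J)"
  by (simp add: levi_def levi_gens_def)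

lemma km_class_in_levi:
  assumes J: "J \<subseteq> index_set D" and t: "t \<in> lie_terms (levi_gens J)"
  shows "km_class D t \<in> levi D J"
proof -
  have mono: "s \<in> lie_terms (km_gens D)" if "s \<in> lie_terms (levi_gens J)" for s
    using that lie_terms_mono levi_gens_mono[OF J] km_gens_eq by metis
  show ?thesis
    using t
  proof (induction t)
    case (LGen x)
    then show ?case
      by (auto simp: levi_eq km_gen_class_eq[symmetric] intro: lie_generated.gen)
  next
    case LZero
    show ?case
      unfolding levi_eq km_zero[symmetric] by (rule lie_generated.zero)
  next
    case (LAdd s t)
    then show ?case
      using lie_generated.add[of _ "km_algebra D"] mono unfolding levi_eq
      by (metis km_class_simps(1) lie_terms_simps(3))
  next
    case (LScale c s)
    then show ?case
      using lie_generated.scale[of _ "km_algebra D"] mono unfolding levi_eq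
      by (metis km_class_simps(2) lie_terms_simps(4))
  next
    case (LBr s t)
    then show ?case
      using lie_generated.bracket[of _ "km_algebra D"] mono unfolding levi_eq
      by (metis km_class_simps(3) lie_terms_simps(5))
  qed
qed

lemma km_carrier: "lie_carrier (km_algebra D) = km_class D ` lie_terms (km_gens D)"
  by (auto simp: km_algebra_def presented_lie_algebra_def km_class_def quotient_def)

text \<open>Allows modules over the whole algebra to be treated as Levi modules, so one locale
  covers both sides of the theorem.\<close>

lemma levi_index_set: "levi_algebra D (index_set D) = km_algebra D"
proof -
  have "x \<in> lie_carrier (km_algebra D)" if "x \<in> levi D (index_set D)" for x
    using that unfolding levi_eq km_gens_eq[symmetric]
  proof (induction rule: lie_generated.induct)
    case (gen x)
    then show ?case by (auto simp: km_carrier km_gen_class_eq)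
  next
    case zero
    then show ?case by (auto simp: km_carrier km_zero)
  qed (auto simp: km_carrier km_class_simps)
  moreover have "x \<in> levi D (index_set D)" if "x \<in> lie_carrier (km_algebra D)" for x
    using that by (auto simp: km_carrier km_gens_eq intro: km_class_in_levi)
  ultimately have "levi D (index_set D) = lie_carrier (km_algebra D)"
    by blast
  then show ?thesis
    by (simp add: levi_algebra_def)
qed

locale levi_module =
  fixes D :: "('h::ab_group_add, 'i) km_datum" and J :: "'i set"
    and M :: "(('h, 'i) km_elem, 'v::ab_group_add) lie_mod"
  assumes J: "J \<subseteq> index_set D" and M: "lie_module (levi_algebra D J) M"
begin

abbreviation V where "V \<equiv> mod_carrier M"
abbreviation T where "T \<equiv> lie_terms (levi_gens J :: ('h, 'i) km_gen set)"

sublocale subspace_ops "mod_scale M" V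
  using M by (simp add: lie_module_def subspace_ops_def subspace_ops_axioms_def)

text \<open>Acting by terms instead of classes lets the defining relations be evaluated
  literally.\<close>

definition act :: "('h, 'i) km_gen lie_term \<Rightarrow> 'v \<Rightarrow> 'v" where
  "act t = mod_act M (km_class D t)"

lemma T_terms: "t \<in> T \<Longrightarrow> t \<in> lie_terms (km_gens D)"
  using lie_terms_mono levi_gens_mono[OF J] km_gens_eq by metis

lemma levi_algebra_simps [simp]:
  "lie_carrier (levi_algebra D J) = levi D J"
  "lie_add (levi_algebra D J) = lie_add (km_algebra D)"
  "lie_scale (levi_algebra D J) = lie_scale (km_algebra D)"
  "lie_bracket (levi_algebra D J) = lie_bracket (km_algebra D)"
  by (simp_all add: levi_algebra_def)

lemma mod_act_endo: "x \<in> levi D J \<Longrightarrow> endo (mod_act M x)"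
  using M by (simp add: lie_module_def endo_def)

lemma act_endo: "t \<in> T \<Longrightarrow> endo (act t)"
  unfolding act_def by (intro mod_act_endo km_class_in_levi J)

lemma mod_act_simps:
  assumes "x \<in> levi D J" "v \<in> V"
  shows "y \<in> levi D J \<Longrightarrow> mod_act M (lie_add (km_algebra D) x y) v = mod_act M x v + mod_act M y v"
    and "mod_act M (lie_scale (km_algebra D) c x) v = mod_scale M c (mod_act M x v)"
    and "y \<in> levi D J \<Longrightarrow> mod_act M (lie_bracket (km_algebra D) x y) v = op_bracket (mod_act M x) (mod_act M y) v"
  using M assms by (simp_all add: lie_module_def op_bracket_def)

lemma act_simps:
  assumes "s \<in> T" "v \<in> V"
  shows "t \<in> T \<Longrightarrow> act (LAdd s t) v = act s v + act t v"
    and "act (LScale c s) v = mod_scale M c (act s v)"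
    and "t \<in> T \<Longrightarrow> act (LBr s t) v = op_bracket (act s) (act t) v"
  using mod_act_simps[OF km_class_in_levi[OF J assms(1)] assms(2)] km_class_in_levi[OF J]
    km_class_simps[of _ D] T_terms assms(1)
  by (metis act_def)+

lemma act_rel:
  assumes "(s, t) \<in> km_rels D" "s \<in> T" "t \<in> T"
  shows "act s = act t"
  using km_class_cong[OF lie_cong.rel] assms T_terms by (metis act_def)

text \<open>The congruence \<open>0 + (-1) 0 = 0\<close> evaluates to
  \<open>act LZero v - act LZero v\<close>, by additivity and homogeneity of the action.\<close>

lemma act_zero:
  assumes "v \<in> V"
  shows "act LZero v = 0"
proof -
  have "act (LAdd LZero (LScale (-1) LZero)) = act LZero"
    unfolding act_def using km_class_cong[OF lie_cong.add_neg, of LZero D] by simp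
  then show ?thesis
    using assms act_simps(1)[of LZero v "LScale (-1) LZero"] act_simps(2)[of LZero v "-1"] by simp
qed

lemma funpow_bracket_in_T: "s \<in> T \<Longrightarrow> t \<in> T \<Longrightarrow> (LBr s ^^ n) t \<in> T"
  by (induction n) auto

lemma act_funpow_bracket:
  assumes "s \<in> T" "t \<in> T" "v \<in> V"
  shows "act ((LBr s ^^ n) t) v = (op_bracket (act s) ^^ n) (act t) v"
  using assms(3)
proof (induction n arbitrary: v)
  case (Suc n)
  have "act s v \<in> V"
    by (rule endoD(1)[OF act_endo[OF assms(1)] Suc.prems])
  then show ?case
    using Suc act_simps(3)[OF assms(1) Suc.prems funpow_bracket_in_T[OF assms(1,2)]]
    by (simp add: op_bracket_def[of "act s"])
qed simp

lemma gens_in_T: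
  "LGen (GH h) \<in> T" "i \<in> J \<Longrightarrow> LGen (GE i) \<in> T" "i \<in> J \<Longrightarrow> LGen (GF i) \<in> T"
  by (auto simp: levi_gens_def)

text \<open>The elements of the algebra preserving \<open>U\<close> are closed under its operations,
  so the generators suffice. This matches the irreducibility axiom of \<open>km_rep\<close>.\<close>

lemma submodule_gens:
  assumes U: "subspace U" "U \<subseteq> V"
    and closed: "\<And>x u. x \<in> levi_gens J \<Longrightarrow> u \<in> U \<Longrightarrow> act (LGen x) u \<in> U"
  shows "submodule (levi_algebra D J) M U"
proof -
  have "\<forall>u\<in>U. mod_act M x u \<in> U" if "x \<in> levi D J" for x
    using that unfolding levi_eq
  proof (induction rule: lie_generated.induct)
    case (gen x)
    then show ?case using closed by (auto simp: act_def km_gen_class_eq)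
  next
    case zero
    then show ?case
      using act_zero U subspace_0[OF U(1)] by (auto simp: km_zero act_def subset_iff)
  next
    case (add x y)
    then show ?case
      using U mod_act_simps(1)[of x _ y] subspace_add[OF U(1)] by (auto simp: levi_eq subset_iff)
  next
    case (scale x c)
    then show ?case
      using U mod_act_simps(2)[of x] subspace_scale[OF U(1)] by (auto simp: levi_eq subset_iff)
  next
    case (bracket x y)
    then show ?case
      using U mod_act_simps(3)[of x _ y] subspace_diff[OF U(1)]
      by (auto simp: levi_eq subset_iff op_bracket_def)
  qed
  then show ?thesis
    using U by (simp add: submodule_def)
qed

abbreviation E where "E i \<equiv> mod_act M (km_gen_class D (GE i))"
abbreviation F where "F i \<equiv> mod_act M (km_gen_class D (GF i))"
abbreviation H where "H h \<equiv> mod_act M (km_gen_class D (GH h))"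

lemma act_gens: "act (LGen x) = mod_act M (km_gen_class D x)"
  by (simp add: act_def km_gen_class_eq)

lemma act_relations:
  assumes v: "v \<in> V"
  shows "i \<in> J \<Longrightarrow> H h (E i v) = E i (H h v) + mod_scale M (simple_root D i h) (E i v)"
    and "i \<in> J \<Longrightarrow> H h (F i v) = F i (H h v) - mod_scale M (simple_root D i h) (F i v)"
    and "i \<in> J \<Longrightarrow> E i (F i v) = F i (E i v) + H (simple_coroot D i) v"
    and "i \<in> J \<Longrightarrow> j \<in> J \<Longrightarrow> i \<noteq> j \<Longrightarrow> E i (F j v) = F j (E i v)"
    and "i \<in> J \<Longrightarrow> j \<in> J \<Longrightarrow> i \<noteq> j \<Longrightarrow> (op_bracket (F i) ^^ nat (1 - cartan D i j)) (F j) v = 0"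
proof -
  note gens = gens_in_T
  have br: "act s (act t v) = act t (act s v) + act u v"
    if "(LBr s t, u) \<in> km_rels D" "s \<in> T" "t \<in> T" "u \<in> T" for s t u
    using act_rel[OF that(1)] act_simps(3)[OF that(2) v that(3)] that by (simp add: op_bracket_def)
  show "H h (E i v) = E i (H h v) + mod_scale M (simple_root D i h) (E i v)" if "i \<in> J"
    using br[OF km_rels.h_e, of i h] gens that J act_simps(2)[OF gens(2)[OF that] v]
    by (auto simp: act_gens)
  show "H h (F i v) = F i (H h v) - mod_scale M (simple_root D i h) (F i v)" if "i \<in> J"
    using br[OF km_rels.h_f, of i h] gens that J act_simps(2)[OF gens(3)[OF that] v]
    by (auto simp: act_gens)
  show "E i (F i v) = F i (E i v) + H (simple_coroot D i) v" if "i \<in> J"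
    using br[OF km_rels.e_f_same, of i] gens that J by (auto simp: act_gens)
  show "E i (F j v) = F j (E i v)" if "i \<in> J" "j \<in> J" "i \<noteq> j"
    using br[OF km_rels.e_f_diff, of i j] gens that J act_zero[OF v] by (auto simp: act_gens)
  show "(op_bracket (F i) ^^ nat (1 - cartan D i j)) (F j) v = 0" if "i \<in> J" "j \<in> J" "i \<noteq> j"
  proof -
    have "act ((LBr (LGen (GF i)) ^^ nat (1 - cartan D i j)) (LGen (GF j))) = act LZero"
      by (rule act_rel[OF km_rels.serre_f]) (use that J funpow_bracket_in_T gens in auto)
    from fun_cong[OF this, of v] show ?thesis
      using act_funpow_bracket[OF gens(3)[OF that(1)] gens(3)[OF that(2)] v] act_zero[OF v]
      by (simp add: act_gens)
  qed
qed

end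

lemma simple_highest_weight_km_rep:
  fixes D :: "('h::ab_group_add, 'i) km_datum"
  assumes D: "realization D" and J: "J \<subseteq> index_set D"
    and M: "simple_highest_weight_module D (levi_algebra D J) M \<nu>"
  obtains v where "km_rep (mod_scale M) (mod_carrier M) D J
    (\<lambda>i. mod_act M (km_gen_class D (GE i))) (\<lambda>i. mod_act M (km_gen_class D (GF i)))
    (\<lambda>h. mod_act M (km_gen_class D (GH h))) \<nu> v"
proof -
  have simple: "simple_module (levi_algebra D J) M"
    and lie: "lie_module (levi_algebra D J) M"
    using M by (simp_all add: simple_highest_weight_module_def simple_module_def)
  interpret levi_module D J M
    by unfold_locales (rule J lie)+
  obtain v where v: "v \<in> weight_space D M \<nu>" "v \<noteq> 0" "\<forall>x\<in>n_plus D \<inter> levi D J. mod_act M x v = 0"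
    using assms(3) by (auto simp: simple_highest_weight_module_def highest_weight_module_def)
  have gens_levi: "km_gen_class D x \<in> levi D J" if "x \<in> levi_gens J" for x
    using that by (auto simp: levi_eq intro: lie_generated.gen)
  show thesis
  proof (rule that[of v], unfold_locales)
    show "realization D" "J \<subseteq> index_set D" by (rule D J)+
    show "endo (E i)" if "i \<in> J" for i
      using that by (intro mod_act_endo gens_levi) (simp add: levi_gens_def)
    show "endo (F i)" if "i \<in> J" for i
      using that by (intro mod_act_endo gens_levi) (simp add: levi_gens_def)
    show "endo (H h)" for h
      by (intro mod_act_endo gens_levi) (simp add: levi_gens_def)
    show "E i v = 0" if "i \<in> J" for i
    proof -
      have "km_gen_class D (GE i) \<in> n_plus D"
        using that J unfolding n_plus_def by (intro lie_generated.gen) auto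
      then show ?thesis
        using v(3) gens_levi[of "GE i"] that by (simp add: levi_gens_def)
    qed
    show "U = {0} \<or> U = V"
      if "subspace U" "U \<subseteq> V" "\<And>i u. i \<in> J \<Longrightarrow> u \<in> U \<Longrightarrow> E i u \<in> U"
        "\<And>i u. i \<in> J \<Longrightarrow> u \<in> U \<Longrightarrow> F i u \<in> U" "\<And>h u. u \<in> U \<Longrightarrow> H h u \<in> U" for U
    proof -
      have "submodule (levi_algebra D J) M U"
        by (rule submodule_gens) (use that in \<open>auto simp: levi_gens_def act_gens\<close>)
      then show ?thesis
        using simple by (simp add: simple_module_def)
    qed
  qed (use v act_relations in \<open>auto simp: weight_space_def\<close>)
qed

section \<open>The slice decomposition\<close>

lemma hdual_diff_sum:
  fixes D :: "('h::ab_group_add, 'i) km_datum"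
  assumes "\<mu> \<in> hdual D" "\<And>i. i \<in> S \<Longrightarrow> r i \<in> hdual D"
  shows "(\<lambda>h. \<mu> h - (\<Sum>i\<in>S. c i * r i h)) \<in> hdual D"
  using assms by (simp add: hdual_def Vector_Spaces.linear_iff sum.distrib sum_distrib_left
      algebra_simps)

text \<open>Coefficients in \<open>nonneg_span\<close> are attached to roots of a chosen finite
  subset; injectivity moves them to indices, with 0 filling in the roots not chosen.\<close>

lemma nonneg_span_iff:
  assumes "finite N" "inj_on r N"
  shows "\<mu> \<in> nonneg_span (r ` N) \<longleftrightarrow>
    (\<exists>n. (\<forall>i. i \<notin> N \<longrightarrow> n i = 0) \<and> \<mu> = (\<lambda>h. \<Sum>i\<in>N. of_nat (n i) * r i h))"
proof
  assume "\<mu> \<in> nonneg_span (r ` N)"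
  then obtain T n where T: "T \<subseteq> r ` N" "\<mu> = (\<lambda>h. \<Sum>\<beta>\<in>T. of_nat (n \<beta>) * \<beta> h)"
    by (auto simp: nonneg_span_def)
  define n' where "n' i = (if i \<in> N \<and> r i \<in> T then n (r i) else 0)" for i
  have "(\<Sum>\<beta>\<in>T. of_nat (n \<beta>) * \<beta> h) = (\<Sum>i\<in>N. of_nat (n' i) * r i h)" for h
  proof -
    have "(\<Sum>\<beta>\<in>T. of_nat (n \<beta>) * \<beta> h) = (\<Sum>\<beta>\<in>r ` N. if \<beta> \<in> T then of_nat (n \<beta>) * \<beta> h else 0)"
      using T assms by (simp add: sum.inter_restrict[symmetric] Int_absorb1)
    also have "\<dots> = (\<Sum>i\<in>N. of_nat (n' i) * r i h)"
      using assms by (auto simp: sum.reindex n'_def intro!: sum.cong)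
    finally show ?thesis .
  qed
  then show "\<exists>n. (\<forall>i. i \<notin> N \<longrightarrow> n i = 0) \<and> \<mu> = (\<lambda>h. \<Sum>i\<in>N. of_nat (n i) * r i h)"
    using T by (intro exI[of _ n']) (auto simp: n'_def)
next
  assume "\<exists>n. (\<forall>i. i \<notin> N \<longrightarrow> n i = 0) \<and> \<mu> = (\<lambda>h. \<Sum>i\<in>N. of_nat (n i) * r i h)"
  then obtain n where "\<mu> = (\<lambda>h. \<Sum>i\<in>N. of_nat (n i) * r i h)" by blast
  also have "\<dots> = (\<lambda>h. \<Sum>\<beta>\<in>r ` N. of_nat (n (inv_into N r \<beta>)) * \<beta> h)"
    using assms by (simp add: sum.reindex)
  finally show "\<mu> \<in> nonneg_span (r ` N)"
    unfolding nonneg_span_def using assms(1)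
    by (intro CollectI exI[of _ "r ` N"] exI[of _ "\<lambda>\<beta>. n (inv_into N r \<beta>)"]) simp
qed

lemma (in km_rep) wt_eq:
  fixes M :: "(('h, 'i) km_elem, 'v) lie_mod"
  assumes "\<Lambda> \<in> hdual D" "scale = mod_scale M" "V = mod_carrier M"
    "H = (\<lambda>h. mod_act M (km_gen_class D (GH h)))"
  shows "wt D M = wtof ` wts"
proof -
  have "weight_space D M \<chi> = wvec \<chi>" for \<chi>
    unfolding weight_space_def wvec_def using assms by simp
  moreover have "wtof n \<in> hdual D" for n
    unfolding wtof_def using assms(1) gcm(5) by (rule hdual_diff_sum)
  ultimately show ?thesis
    by (auto simp: wt_def wvec_nonzero_iff)
qed

theorem proposition2p3:
  fixes D :: "('h::ab_group_add, 'i) km_datum"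
    and lam :: "'h \<Rightarrow> complex"
    and L :: "(('h, 'i) km_elem, 'v::ab_group_add) lie_mod"
    and LL :: "('h \<Rightarrow> complex) \<Rightarrow> (('h, 'i) km_elem, 'w::ab_group_add) lie_mod"
  assumes "realization D"
    and "lam \<in> hdual D"
    and "simple_highest_weight_module D (km_algebra D) L lam"
    and "\<And>\<mu>. \<mu> \<in> nonneg_span (simple_root D ` (index_set D - integral_index D lam)) \<Longrightarrow>
      simple_highest_weight_module D (levi_algebra D (integral_index D lam)) (LL \<mu>) (lam - \<mu>)"
  shows "wt D L =
      (\<Union>\<mu>\<in>nonneg_span (simple_root D ` (index_set D - integral_index D lam)). wt D (LL \<mu>)) \<and>
    disjoint_family_on (\<lambda>\<mu>. wt D (LL \<mu>))
      (nonneg_span (simple_root D ` (index_set D - integral_index D lam)))"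
proof -
  define I where "I = index_set D"
  define J where "J = integral_index D lam"
  define N where "N = I - J"
  note gcm = realization_gcm[OF assms(1), folded I_def]
  have J: "J \<subseteq> I" and N: "N \<subseteq> I" and fin: "finite J" "finite N"
    using gcm(1) by (auto simp: J_def N_def I_def integral_index_def intro: finite_subset)
  have integral: "lam (simple_coroot D i) \<in> \<nat> \<longleftrightarrow> i \<in> J" if "i \<in> I" for i
    using that by (simp add: J_def I_def integral_index_def)
  obtain v where R: "km_rep (mod_scale L) (mod_carrier L) D I
    (\<lambda>i. mod_act L (km_gen_class D (GE i))) (\<lambda>i. mod_act L (km_gen_class D (GF i)))
    (\<lambda>h. mod_act L (km_gen_class D (GH h))) lam v"
    using simple_highest_weight_km_rep[OF assms(1) order_refl, unfolded levi_index_set, OF assms(3)]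
    unfolding I_def .
  interpret R: km_rep "mod_scale L" "mod_carrier L" D I
    "\<lambda>i. mod_act L (km_gen_class D (GE i))" "\<lambda>i. mod_act L (km_gen_class D (GF i))"
    "\<lambda>h. mod_act L (km_gen_class D (GH h))" lam v
    by (rule R)
  define \<mu> where "\<mu> n = (\<lambda>h. \<Sum>i\<in>N. of_nat (n i) * simple_root D i h)" for n :: "'i \<Rightarrow> nat"
  have span_eq: "nonneg_span (simple_root D ` N) = \<mu> ` {n. \<forall>i. i \<notin> N \<longrightarrow> n i = 0}"
    using nonneg_span_iff[OF fin(2) inj_on_subset[OF gcm(6) N]] by (auto simp: \<mu>_def)
  \<comment> \<open>The core of the proof: the slice of \<open>L\<close> at \<open>n0\<close> and
    the slice of \<open>LL (\<mu> n0)\<close> at 0 are weight slices for the same data and both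
    contain 0, so each includes the other.\<close>
  have wt_LL: "wt D (LL (\<mu> n0)) = (\<lambda>\<beta>. R.wtof (\<lambda>i. n0 i + \<beta> i)) ` R.slice J n0"
    if n0: "\<forall>i. i \<notin> N \<longrightarrow> n0 i = 0" for n0
  proof -
    have "\<mu> n0 h = (\<Sum>i\<in>I. of_nat (n0 i) * simple_root D i h)" for h
      unfolding \<mu>_def using n0 N gcm(1) by (intro sum.mono_neutral_left) auto
    then have top: "lam - \<mu> n0 = R.wtof n0"
      by (simp add: R.wtof_def fun_eq_iff I_def)
    have "\<mu> n0 \<in> nonneg_span (simple_root D ` N)"
      unfolding span_eq using n0 by blast
    then have "simple_highest_weight_module D (levi_algebra D J) (LL (\<mu> n0)) (R.wtof n0)"
      using assms(4) unfolding top[symmetric] N_def I_def J_def by blast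
    then obtain u where S: "km_rep (mod_scale (LL (\<mu> n0))) (mod_carrier (LL (\<mu> n0))) D J
      (\<lambda>i. mod_act (LL (\<mu> n0)) (km_gen_class D (GE i)))
      (\<lambda>i. mod_act (LL (\<mu> n0)) (km_gen_class D (GF i)))
      (\<lambda>h. mod_act (LL (\<mu> n0)) (km_gen_class D (GH h))) (R.wtof n0) u"
      by (rule simple_highest_weight_km_rep[OF assms(1) J[unfolded I_def]])
    interpret S: km_rep "mod_scale (LL (\<mu> n0))" "mod_carrier (LL (\<mu> n0))" D J
      "\<lambda>i. mod_act (LL (\<mu> n0)) (km_gen_class D (GE i))"
      "\<lambda>i. mod_act (LL (\<mu> n0)) (km_gen_class D (GF i))"
      "\<lambda>h. mod_act (LL (\<mu> n0)) (km_gen_class D (GH h))" "R.wtof n0" u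
      by (rule S)
    obtain k where k: "\<And>i. i \<in> J \<Longrightarrow> lam (simple_coroot D i) = of_nat (k i)"
    proof -
      have "\<forall>i\<in>J. \<exists>k. lam (simple_coroot D i) = of_nat k"
        using integral J by (auto simp: Nats_def)
      then show thesis
        using that by metis
    qed
    \<comment> \<open>The values of \<open>lam - \<mu> n0\<close> at the coroots in
      \<open>J\<close>. They are nonnegative because \<open>n0\<close> lives off \<open>J\<close>,
      where only nonpositive Cartan entries occur.\<close>
    define c where "c i = int (k i) - (\<Sum>j\<in>I. cartan D i j * int (n0 j))" for i
    have c: "of_int (c i) = R.wtof n0 (simple_coroot D i)" if "i \<in> J" for i
      using R.wtof_coroot[of i n0] that J k by (auto simp: c_def I_def)
    have c_nonneg: "0 \<le> c i" if i: "i \<in> J" for i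
    proof -
      have "cartan D i j * int (n0 j) \<le> 0" if "j \<in> I" for j
      proof (cases "j \<in> N")
        case True
        then have "cartan D i j \<le> 0"
          using i J that gcm(3)[of i j] by (auto simp: N_def)
        then show ?thesis by (simp add: mult_nonpos_nonneg)
      qed (simp add: n0)
      then have "(\<Sum>j\<in>I. cartan D i j * int (n0 j)) \<le> 0"
        by (intro sum_nonpos)
      then show ?thesis by (simp add: c_def)
    qed
    have top_integral: "R.wtof n0 (simple_coroot D i) \<in> \<nat>" if "i \<in> J" for i
      using c_nonneg[OF that] c[OF that] by (metis of_int_of_nat_eq of_nat_in_Nats nonneg_int_cases)
    have slice_R: "weight_slice J (cartan D) c (R.slice J n0)"
      by (rule R.weight_slice_slice) (use J integral n0 c in \<open>auto simp: N_def\<close>)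
    have slice_S: "weight_slice J (cartan D) c (S.slice J (\<lambda>_. 0))"
      by (rule S.weight_slice_slice) (use top_integral c in \<open>auto simp: S.wtof_zero\<close>)
    \<comment> \<open>Every letter of \<open>n0\<close> is nonintegral for \<open>lam\<close>, so
      the top weight of the Levi module really occurs in \<open>L\<close>.\<close>
    have "n0 \<in> R.wts"
      by (rule R.wts_nonintegral) (use n0 integral in \<open>auto simp: N_def\<close>)
    then have "(\<lambda>_. 0) \<in> R.slice J n0"
      by (simp add: R.slice_def)
    moreover have "(\<lambda>_. 0) \<in> S.slice J (\<lambda>_. 0)"
      using S.wts_nonintegral[of "\<lambda>_. 0"] by (simp add: S.slice_def)
    moreover have "Q \<subseteq> P"
      if "weight_slice J (cartan D) c Q" "weight_slice J (cartan D) c P" "(\<lambda>_. 0) \<in> P" for P Q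
    proof (rule weight_slice_subset[OF fin(1) _ _ c_nonneg that])
      show "cartan D i i = 2" if "i \<in> J" for i
        using that J gcm(2) by blast
      show "cartan D i j \<le> 0" if "i \<in> J" "j \<in> J" "i \<noteq> j" for i j
        using that J gcm(3) by blast
    qed
    ultimately have "R.slice J n0 = S.slice J (\<lambda>_. 0)"
      using slice_R slice_S by blast
    also have "\<dots> = S.wts"
      using S.wts_support by (auto simp: S.slice_def)
    finally have "R.slice J n0 = S.wts" .
    moreover have "S.wtof \<beta> = R.wtof (\<lambda>i. n0 i + \<beta> i)" for \<beta>
      by (simp add: R.wtof_add S.wtof_def)
    moreover have "R.wtof n0 \<in> hdual D"
      unfolding R.wtof_def using assms(2) R.gcm(5) by (rule hdual_diff_sum)
    ultimately show ?thesis
      using S.wt_eq[of "LL (\<mu> n0)"] by simp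
  qed
  have wt_L: "wt D L = R.wtof ` R.wts"
    by (rule R.wt_eq) (use assms in auto)
  have "R.wtof n \<in> (\<Union>m\<in>nonneg_span (simple_root D ` N). wt D (LL m))" if n: "n \<in> R.wts" for n
  proof -
    \<comment> \<open>Splitting a weight of \<open>L\<close> into its \<open>N\<close>-part and
      \<open>J\<close>-part: the first selects the Levi module, the second the weight in it.\<close>
    define n0 where "n0 i = (if i \<in> N then n i else 0)" for i
    define \<beta> where "\<beta> i = (if i \<in> J then n i else 0)" for i
    have "n = (\<lambda>i. n0 i + \<beta> i)"
      using R.wts_support[OF n] J by (auto simp: n0_def \<beta>_def N_def)
    then have "\<beta> \<in> R.slice J n0" "R.wtof n = R.wtof (\<lambda>i. n0 i + \<beta> i)"
      using n by (auto simp: R.slice_def \<beta>_def)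
    then have "R.wtof n \<in> wt D (LL (\<mu> n0))"
      using wt_LL[of n0] by (auto simp: n0_def)
    moreover have "\<mu> n0 \<in> nonneg_span (simple_root D ` N)"
      unfolding span_eq by (auto simp: n0_def)
    ultimately show ?thesis by blast
  qed
  moreover have "wt D (LL m) \<subseteq> R.wtof ` R.wts" if "m \<in> nonneg_span (simple_root D ` N)" for m
  proof -
    obtain n where n: "\<forall>i. i \<notin> N \<longrightarrow> n i = 0" "m = \<mu> n"
      using \<open>m \<in> nonneg_span (simple_root D ` N)\<close> unfolding span_eq by blast
    show ?thesis
      unfolding n(2) wt_LL[OF n(1)] by (auto simp: R.slice_def)
  qed
  ultimately have "wt D L = (\<Union>m\<in>nonneg_span (simple_root D ` N). wt D (LL m))"
    unfolding wt_L by blast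
  moreover have "disjoint_family_on (\<lambda>m. wt D (LL m)) (nonneg_span (simple_root D ` N))"
    unfolding disjoint_family_on_def
  proof (intro ballI impI)
    fix m m' assume "m \<in> nonneg_span (simple_root D ` N)" "m' \<in> nonneg_span (simple_root D ` N)"
      and ne: "m \<noteq> m'"
    then obtain n n' where n: "\<forall>i. i \<notin> N \<longrightarrow> n i = 0" "m = \<mu> n"
      and n': "\<forall>i. i \<notin> N \<longrightarrow> n' i = 0" "m' = \<mu> n'"
      unfolding span_eq by blast
    \<comment> \<open>A common weight determines its exponent vector, whose restriction to
      \<open>N\<close> recovers both \<open>n\<close> and \<open>n'\<close>.\<close>
    have False if "\<beta> \<in> R.slice J n" "\<beta>' \<in> R.slice J n'"
      and eq: "R.wtof (\<lambda>i. n i + \<beta> i) = R.wtof (\<lambda>i. n' i + \<beta>' i)" for \<beta> \<beta>'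
    proof -
      have "(\<lambda>i. n i + \<beta> i) = (\<lambda>i. n' i + \<beta>' i)"
        by (rule R.wtof_eqI[OF eq]) (use that R.wts_support in \<open>auto simp: R.slice_def\<close>)
      moreover have "\<beta> i = 0 \<and> \<beta>' i = 0" if "i \<in> N" for i
        using that \<open>\<beta> \<in> R.slice J n\<close> \<open>\<beta>' \<in> R.slice J n'\<close> by (auto simp: R.slice_def N_def)
      ultimately have "n i = n' i" for i
        using n(1) n'(1) by (metis add.right_neutral)
      then have "m = m'"
        using n(2) n'(2) by presburger
      then show False using ne by simp
    qed
    then show "wt D (LL m) \<inter> wt D (LL m') = {}"
      unfolding n(2) n'(2) wt_LL[OF n(1)] wt_LL[OF n'(1)] by blast
  qed
  ultimately show ?thesis
    unfolding N_def I_def J_def by (rule conjI)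
qed

end
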